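(* Let $m\in\mathbb{N}$ and let $(X_i)_{i\in\mathbb{N}}$ be identically distributed elements of a noncommutative probability space $(\mathcal{A},\phi)$ which are $m$-monotone w.r.t. $\phi$, with $\phi(X_i)=0$, $\phi(X_i^2)=1$. For $f=\chi_{(s,t]}\in\Theta$ put $S_N(f)=\frac{1}{\sqrt{N}}\sum_{i=[sN]+1}^{[tN]}X_i$. Let $f_1,\dots,f_n\in\Theta$ have pairwise identical or disjoint supports, let $\sigma=\{\sigma_1,\dots,\sigma_p\}$ be the partition of $\{1,\dots,n\}$ in which $j,l$ lie in the same block iff $f_j=f_l$, and let $b_k=|\sigma_k|/2$. Then $$\lim_{N\to\infty}\phi(S_N(f_1)S_N(f_2)\cdots S_N(f_n))=\frac{1}{b_1!b_2!\cdots b_p!}\sum_{\substack{P\in\mathcal{ONC}^2_n(m)\\ P\sim(f_1,\dots,f_n)}}\ \prod_{\{\alpha,\beta\}\in P}\langle f_\alpha,f_\beta\rangle,$$ with the understanding that $\mathcal{ONC}^2_n(m)=\emptyset$ for $n$ odd (so the right side is $0$).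
   Context: $\Theta=\{\chi_{(s,t]}:0\le s<t<\infty\}$, with $\langle\cdot,\cdot\rangle$ the inner product of $L^2(\mathbb{R}_+)$. Partial order on $\Theta$: $\chi_{(s_1,t_1]}<\chi_{(s_2,t_2]}$ iff $t_1\le s_2$; $f\le g$ iff $f<g$ or $f=g$. An ordered partition $P=(P_1,\dots,P_k)$ of $\{1,\dots,n\}$ is compatible with $(f_1,\dots,f_n)$, written $P\sim(f_1,\dots,f_n)$, if (1) $i,j\in P_k\Rightarrow f_i=f_j$, and (2) $i\in P_k$, $j\in P_l$, $k<l\Rightarrow f_i\le f_j$. An ordered partition of $\{1,\dots,n\}$ is a tuple $P=(P_1,\dots,P_k)$ of pairwise disjoint nonempty sets (blocks) with union $\{1,\dots,n\}$; the index $r$ is the order (color) of $P_r$. $P$ is non-crossing if there are no $s<r<s'<r'$ with $s,s'\in P_i$, $r,r'\in P_j$, $i\ne j$. Block $P_i$ is inner w.r.t. $P_j$ (written $P_j<P_i$) if there are $p<q$ in $P_j$ with no element of $P_j$ strictly between them and $p<s<q$ for all $s\in P_i$. The depth $d(P_i)$ is $1$ plus the number of blocks w.r.t. which $P_i$ is inner. $\mathcal{ONC}_n(m)$ is the set of ordered non-crossing partitions with: $d(P_j)\ge m$ and $P_j<P_i$ imply $j<i$; $\mathcal{ONC}^2_n(m)$ its subset with all blocks of size two. $m$-monotonicity: let $I$ be linearly ordered, $\{\mathcal{A}_i\}_{i\in I}$ $*$-subalgebras of $\mathcal{A}$, $1_i\in\mathcal{A}_i$ projections which are units of $\mathcal{A}_i$.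 $\{1_i\}$ is an $m$-monotone family of units w.r.t. $\phi$ if $\phi(1_i)=1$ and, for all $n$, $1\le j\le n$, indices $i_1,\dots,i_n$, $a_k\in\mathcal{A}_{i_k}\cap\mathrm{Ker}\,\phi$ ($k<j$), $a_k\in\mathcal{A}_{i_k}$ ($k>j$): $\phi(a_1\cdots a_{j-1}1_{i_j}a_{j+1}\cdots a_n)=\phi(a_1\cdots a_{j-1}a_{j+1}\cdots a_n)$ if $j\le m$ or $m<j\le r$ for some $r$ with $i_1\ne\cdots\ne i_m<i_{m+1}<\cdots<i_r>i_{r+1}$, and $=0$ otherwise. $\{\mathcal{A}_i\}$ are $m$-monotone w.r.t. $\phi$ if such units exist and $\phi(a_1\cdots a_n)=0$ whenever $a_k\in\mathcal{A}_{i_k}\cap\mathrm{Ker}\,\phi$ and $i_1\ne i_2\ne\cdots\ne i_n$. $(X_i)_{i\in\mathbb{N}}$ are $m$-monotone if $X_i\in\mathcal{A}_i$ for $m$-monotone $*$-subalgebras $\{\mathcal{A}_i\}_{i\in\mathbb{N}}$. Identically distributed means $\phi(X_i^k)$ is independent of $i$.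
   Formalization: In the definition of m-monotone units the condition is imposed only for index words with i_1≠i_2≠…≠i_n (and i_r>i_{r+1} is void when r=n); imposed for all words it would contradict φ(X_i²)=1. *)

theory Defs
  imports "HOL-Analysis.Analysis"
begin

definition star_algebra :: "(complex \<Rightarrow> 'a::ring_1 \<Rightarrow> 'a) \<Rightarrow> ('a \<Rightarrow> 'a) \<Rightarrow> bool" where
  "star_algebra sm st \<longleftrightarrow>
     (\<forall>c d a b. sm c (a + b) = sm c a + sm c b \<and> sm (c + d) a = sm c a + sm d a
        \<and> sm (c * d) a = sm c (sm d a) \<and> sm 1 a = a
        \<and> sm c (a * b) = sm c a * b \<and> sm c (a * b) = a * sm c b)
   \<and> (\<forall>c a b. st (a + b) = st a + st b \<and> st (sm c a) = sm (cnj c) (st a)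
        \<and> st (a * b) = st b * st a \<and> st (st a) = a)"

definition nc_state :: "(complex \<Rightarrow> 'a::ring_1 \<Rightarrow> 'a) \<Rightarrow> ('a \<Rightarrow> 'a) \<Rightarrow> ('a \<Rightarrow> complex) \<Rightarrow> bool" where
  "nc_state sm st \<phi> \<longleftrightarrow>
     (\<forall>c a b. \<phi> (a + b) = \<phi> a + \<phi> b \<and> \<phi> (sm c a) = c * \<phi> a)
   \<and> \<phi> 1 = 1
   \<and> (\<forall>a. Im (\<phi> (st a * a)) = 0 \<and> Re (\<phi> (st a * a)) \<ge> 0)"

definition nc_prob_space :: "(complex \<Rightarrow> 'a::ring_1 \<Rightarrow> 'a) \<Rightarrow> ('a \<Rightarrow> 'a) \<Rightarrow> ('a \<Rightarrow> complex) \<Rightarrow> bool" where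
  "nc_prob_space sm st \<phi> \<longleftrightarrow> star_algebra sm st \<and> nc_state sm st \<phi>"

text \<open>*-subalgebra (not necessarily containing the unit of the big algebra).\<close>
definition star_subalgebra :: "(complex \<Rightarrow> 'a::ring_1 \<Rightarrow> 'a) \<Rightarrow> ('a \<Rightarrow> 'a) \<Rightarrow> 'a set \<Rightarrow> bool" where
  "star_subalgebra sm st B \<longleftrightarrow> 0 \<in> B \<and> (\<forall>a\<in>B. \<forall>b\<in>B. a + b \<in> B \<and> a * b \<in> B)
     \<and> (\<forall>c. \<forall>a\<in>B. sm c a \<in> B) \<and> (\<forall>a\<in>B. st a \<in> B)"

text \<open>Index words are 0-based lists: the paper's i_k is is!(k-1).
  Consecutive indices distinct: i_1 \<noteq> i_2 \<noteq> ... \<noteq> i_n.\<close>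
definition alternating :: "'i list \<Rightarrow> bool" where
  "alternating is \<longleftrightarrow> (\<forall>k. Suc k < length is \<longrightarrow> is ! k \<noteq> is ! Suc k)"

text \<open>The paper's condition on the (1-based) position J = j+1 of the unit:
  J \<le> m, or m < J \<le> r for some r with i_1 \<noteq> ... \<noteq> i_m < i_{m+1} < ... < i_r > i_{r+1}
  (the last comparison being vacuous when r = n).\<close>
definition unit_cond :: "nat \<Rightarrow> 'i::linorder list \<Rightarrow> nat \<Rightarrow> bool" where
  "unit_cond m is j \<longleftrightarrow> Suc j \<le> m \<or>
     (\<exists>r. Suc j \<le> r \<and> r \<le> length is
        \<and> (\<forall>k. 1 \<le> k \<and> Suc k \<le> m \<longrightarrow> is ! (k - 1) \<noteq> is ! k)
        \<and> (\<forall>k. m \<le> k \<and> k < r \<longrightarrow> is ! (k - 1) < is ! k)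
        \<and> (r < length is \<longrightarrow> is ! r < is ! (r - 1)))"

text \<open>m-monotone family of units. The list as has length n; its entry at the position j
  of the unit is irrelevant (it is replaced by the unit u (is!j)).\<close>
definition m_monotone_units ::
  "nat \<Rightarrow> (complex \<Rightarrow> 'a::ring_1 \<Rightarrow> 'a) \<Rightarrow> ('a \<Rightarrow> 'a) \<Rightarrow> ('a \<Rightarrow> complex)
     \<Rightarrow> ('i::linorder \<Rightarrow> 'a set) \<Rightarrow> ('i \<Rightarrow> 'a) \<Rightarrow> bool" where
  "m_monotone_units m sm st \<phi> Alg u \<longleftrightarrow>
     (\<forall>i. u i \<in> Alg i \<and> st (u i) = u i \<and> u i * u i = u i
          \<and> (\<forall>a\<in>Alg i. u i * a = a \<and> a * u i = a) \<and> \<phi> (u i) = 1)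
   \<and> (\<forall>is as j. length as = length is \<and> j < length is \<and> alternating is
        \<and> (\<forall>k<length is. k \<noteq> j \<longrightarrow> as ! k \<in> Alg (is ! k))
        \<and> (\<forall>k<j. \<phi> (as ! k) = 0)
      \<longrightarrow> \<phi> (prod_list (take j as) * u (is ! j) * prod_list (drop (Suc j) as))
          = (if unit_cond m is j then \<phi> (prod_list (take j as) * prod_list (drop (Suc j) as))
             else 0))"

definition m_monotone ::
  "nat \<Rightarrow> (complex \<Rightarrow> 'a::ring_1 \<Rightarrow> 'a) \<Rightarrow> ('a \<Rightarrow> 'a) \<Rightarrow> ('a \<Rightarrow> complex)
     \<Rightarrow> ('i::linorder \<Rightarrow> 'a set) \<Rightarrow> bool" where
  "m_monotone m sm st \<phi> Alg \<longleftrightarrow>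
     (\<forall>i. star_subalgebra sm st (Alg i))
   \<and> (\<exists>u. m_monotone_units m sm st \<phi> Alg u)
   \<and> (\<forall>is as. is \<noteq> [] \<and> length as = length is \<and> alternating is
        \<and> (\<forall>k<length is. as ! k \<in> Alg (is ! k) \<and> \<phi> (as ! k) = 0)
      \<longrightarrow> \<phi> (prod_list as) = 0)"

definition m_monotone_vars ::
  "nat \<Rightarrow> (complex \<Rightarrow> 'a::ring_1 \<Rightarrow> 'a) \<Rightarrow> ('a \<Rightarrow> 'a) \<Rightarrow> ('a \<Rightarrow> complex) \<Rightarrow> (nat \<Rightarrow> 'a) \<Rightarrow> bool" where
  "m_monotone_vars m sm st \<phi> X \<longleftrightarrow>
     (\<exists>Alg :: nat \<Rightarrow> 'a set. m_monotone m sm st \<phi> Alg \<and> (\<forall>i. X i \<in> Alg i))"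

definition identically_distributed :: "('a::ring_1 \<Rightarrow> complex) \<Rightarrow> (nat \<Rightarrow> 'a) \<Rightarrow> bool" where
  "identically_distributed \<phi> X \<longleftrightarrow> (\<forall>k i j. \<phi> (X i ^ k) = \<phi> (X j ^ k))"

text \<open>An element of Theta is given by its interval (s,t]; chi (s,t) is the indicator function.\<close>
definition chi :: "real \<times> real \<Rightarrow> real \<Rightarrow> real" where
  "chi p = indicator {fst p<..snd p}"

definition in_Theta :: "real \<times> real \<Rightarrow> bool" where
  "in_Theta p \<longleftrightarrow> 0 \<le> fst p \<and> fst p < snd p"

definition L2_inner :: "(real \<Rightarrow> real) \<Rightarrow> (real \<Rightarrow> real) \<Rightarrow> real" where
  "L2_inner f g = (LINT x|lborel. indicator {0..} x * f x * g x)"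

definition theta_less :: "real \<times> real \<Rightarrow> real \<times> real \<Rightarrow> bool" where
  "theta_less p q \<longleftrightarrow> snd p \<le> fst q"

definition theta_le :: "real \<times> real \<Rightarrow> real \<times> real \<Rightarrow> bool" where
  "theta_le p q \<longleftrightarrow> theta_less p q \<or> chi p = chi q"

definition S_N :: "(complex \<Rightarrow> 'a::ring_1 \<Rightarrow> 'a) \<Rightarrow> (nat \<Rightarrow> 'a) \<Rightarrow> nat \<Rightarrow> real \<times> real \<Rightarrow> 'a" where
  "S_N sm X N p = sm (complex_of_real (1 / sqrt (real N)))
      (\<Sum>i\<in>{nat \<lfloor>fst p * real N\<rfloor> + 1 .. nat \<lfloor>snd p * real N\<rfloor>}. X i)"

text \<open>Ordered partitions of {0..<n} (0-based positions): list of blocks, P!r has colour r.\<close>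
definition ordered_partition :: "nat \<Rightarrow> nat set list \<Rightarrow> bool" where
  "ordered_partition n P \<longleftrightarrow>
     (\<forall>r<length P. P ! r \<noteq> {}) \<and>
     (\<forall>r<length P. \<forall>r'<length P. r \<noteq> r' \<longrightarrow> P ! r \<inter> P ! r' = {}) \<and>
     \<Union> (set P) = {..<n}"

definition non_crossing :: "nat set list \<Rightarrow> bool" where
  "non_crossing P \<longleftrightarrow> \<not> (\<exists>i<length P. \<exists>j<length P. i \<noteq> j \<and>
      (\<exists>s r s' r'. s < r \<and> r < s' \<and> s' < r' \<and> s \<in> P ! i \<and> s' \<in> P ! i \<and> r \<in> P ! j \<and> r' \<in> P ! j))"

definition inner :: "nat set list \<Rightarrow> nat \<Rightarrow> nat \<Rightarrow> bool" where
  "inner P j i \<longleftrightarrow> (\<exists>p\<in>P ! j. \<exists>q\<in>P ! j. p < q \<and> (\<forall>x\<in>P ! j. \<not> (p < x \<and> x < q))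
      \<and> (\<forall>s\<in>P ! i. p < s \<and> s < q))"

definition depth :: "nat set list \<Rightarrow> nat \<Rightarrow> nat" where
  "depth P i = 1 + card {j. j < length P \<and> inner P j i}"

definition ONC :: "nat \<Rightarrow> nat \<Rightarrow> nat set list set" where
  "ONC n m = {P. ordered_partition n P \<and> non_crossing P \<and>
      (\<forall>i<length P. \<forall>j<length P. depth P j \<ge> m \<and> inner P j i \<longrightarrow> j < i)}"

definition ONC2 :: "nat \<Rightarrow> nat \<Rightarrow> nat set list set" where
  "ONC2 n m = {P \<in> ONC n m. \<forall>B\<in>set P. card B = 2}"

definition compatible :: "nat set list \<Rightarrow> (real \<times> real) list \<Rightarrow> bool" where
  "compatible P fs \<longleftrightarrow>
     (\<forall>k<length P. \<forall>i\<in>P ! k. \<forall>j\<in>P ! k. chi (fs ! i) = chi (fs ! j)) \<and>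
     (\<forall>k<length P. \<forall>l<length P. k < l \<longrightarrow>
        (\<forall>i\<in>P ! k. \<forall>j\<in>P ! l. theta_le (fs ! i) (fs ! j)))"

definition sigma_part :: "(real \<times> real) list \<Rightarrow> nat set set" where
  "sigma_part fs = (\<lambda>j. {l. l < length fs \<and> chi (fs ! l) = chi (fs ! j)}) ` {..<length fs}"

end

theory Submission
  imports Defs
begin

text \<open>
  Expand \<open>\<phi> (S\<^sub>N f\<^sub>1 \<dots> S\<^sub>N f\<^sub>n)\<close> over index words. Writing an element as its centred part
  plus a multiple of the unit of its algebra, and deleting units by the \<open>m\<close>-monotone rule, shows
  that moments are bounded uniformly in the index word and vanish as soon as some index occurs once.
  Hence only words in which every index occurs exactly twice survive the normalisation. For these
  the leftmost adjacent pair \<open>i i\<close> can be replaced by a unit: it disappears if the indices in front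
  of it, from position \<open>m\<close> on, increase up to \<open>i\<close>, and kills the moment otherwise. In a non-crossing
  word the letters in front of that pair are exactly the blocks around it, listed by depth, so the
  moment is \<open>1\<close> or \<open>0\<close> according to whether the ordered kernel of the word lies in \<open>ONC2\<close>.
  Counting words with a given ordered kernel amounts to choosing subsets of fixed size in each
  interval, which yields the binomial asymptotics \<open>(t - s) ^ b / b!\<close>.
\<close>

section \<open>Moments of m-monotone algebras\<close>

text \<open>The defining rules apply only to alternating index words, and the letters in front of a
  unit must be centred. Multiplying equal neighbours may destroy centring, and deleting a unit may
  destroy alternation. The moment arguments therefore leave the words in \<open>X\<close> and run
  over words of arbitrary algebra elements, ordered first by length and then by the number of
  uncentred letters. The uniform bound meets a second obstacle: there are infinitely many index
  words, so no constant may depend on an index. Polynomials in \<open>X i\<close> whose coefficients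
  are the same for all \<open>i\<close> have moments that do not depend on \<open>i\<close>, and the
  reduction is carried out on finite lists of such polynomials. Crossing pair words need no separate
  evaluation. Deleting an adjacent pair neither creates nor removes a crossing, so such a word is
  either killed by a unit on the way or ends as a nonempty alternating word of centred letters. The
  factorials factor out of the sum over partitions because every block uses two positions: the
  number of blocks in an interval is then fixed by \<open>fs\<close> alone.\<close>

lemma alternating_iff_successively: "alternating xs \<longleftrightarrow> successively (\<noteq>) xs"
  by (auto simp: alternating_def successively_conv_nth)

text \<open>Taking the leftmost equal neighbours makes the word up to the first of them alternate,
  as the unit rule requires once the pair is replaced by a unit.\<close>

lemma not_alternating_first_pair:
  assumes "\<not> alternating w"
  shows "\<exists>xs i ys. w = xs @ i # i # ys \<and> alternating (xs @ [i])"
  using assms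
proof (induction w)
  case Nil
  then show ?case by (simp add: alternating_iff_successively)
next
  case (Cons a w)
  show ?case
  proof (cases "w \<noteq> [] \<and> a = hd w")
    case True
    then have "a # w = [] @ a # a # tl w" by (cases w) auto
    moreover have "alternating ([] @ [a])" by (simp add: alternating_iff_successively)
    ultimately show ?thesis by blast
  next
    case False
    then have "\<not> alternating w"
      using Cons.prems by (auto simp: alternating_iff_successively successively_Cons)
    then obtain xs i ys where w: "w = xs @ i # i # ys" "alternating (xs @ [i])"
      using Cons.IH by blast
    have "a # w = (a # xs) @ i # i # ys" using w by simp
    moreover have "alternating ((a # xs) @ [i])"
      using w False by (cases xs) (auto simp: alternating_iff_successively successively_Cons)
    ultimately show ?thesis by blast
  qed
qed

text \<open>Alternation supplies the inequalities up to position \<open>m\<close> and turns a failed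
  ascent into a strict descent. The existential \<open>r\<close> can thus be taken as the end of the
  maximal increasing run, and only the ascent up to the unit remains as a condition. For
  \<open>Suc j \<le> m\<close> the dropped list has at most one entry.\<close>

lemma unit_cond_iff_sorted:
  fixes "is" :: "'i::linorder list"
  assumes m: "1 \<le> m" and alt: "alternating is" and j: "j < length is"
  shows "unit_cond m is j \<longleftrightarrow> sorted_wrt (<) (drop (m - 1) (take (Suc j) is))"
proof -
  have eq: "sorted_wrt (<) (drop (m - 1) (take r is)) \<longleftrightarrow>
      (\<forall>k. m \<le> k \<and> k < r \<longrightarrow> is ! (k - 1) < is ! k)" if r: "r \<le> length is" for r
  proof -
    have "sorted_wrt (<) (drop (m - 1) (take r is)) \<longleftrightarrow>
        (\<forall>i. Suc i < r - (m - 1) \<longrightarrow> is ! (m - 1 + i) < is ! (m - 1 + Suc i))"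
      using r by (auto simp: sorted_wrt_iff_nth_Suc_transp)
    also have "\<dots> \<longleftrightarrow> (\<forall>k. m \<le> k \<and> k < r \<longrightarrow> is ! (k - 1) < is ! k)" (is "?L \<longleftrightarrow> ?R")
    proof
      assume L: ?L
      show ?R
      proof (intro allI impI)
        fix k assume k: "m \<le> k \<and> k < r"
        then have e: "m - 1 + (k - m) = k - 1" "m - 1 + Suc (k - m) = k" using m by auto
        have "Suc (k - m) < r - (m - 1)" using k m by linarith
        with L[rule_format, of "k - m"] show "is ! (k - 1) < is ! k" unfolding e by blast
      qed
    next
      assume R: ?R
      show ?L
      proof (intro allI impI)
        fix i assume i: "Suc i < r - (m - 1)"
        have "m \<le> m + i \<and> m + i < r" using i m by linarith
        then have "is ! (m + i - 1) < is ! (m + i)" using R by blast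
        moreover have "m - 1 + i = m + i - 1" "m - 1 + Suc i = m + i" using m by auto
        ultimately show "is ! (m - 1 + i) < is ! (m - 1 + Suc i)" by simp
      qed
    qed
    finally show ?thesis .
  qed
  let ?Q = "\<lambda>r. r \<le> length is \<and> (\<forall>k. m \<le> k \<and> k < r \<longrightarrow> is ! (k - 1) < is ! k)"
  have "unit_cond m is j \<longleftrightarrow> (\<forall>k. m \<le> k \<and> k < Suc j \<longrightarrow> is ! (k - 1) < is ! k)"
  proof
    assume "unit_cond m is j"
    then show "\<forall>k. m \<le> k \<and> k < Suc j \<longrightarrow> is ! (k - 1) < is ! k"
      unfolding unit_cond_def by auto
  next
    assume "\<forall>k. m \<le> k \<and> k < Suc j \<longrightarrow> is ! (k - 1) < is ! k"
    then have Q: "?Q (Suc j)" using j by auto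
    define r where "r = (GREATEST r. ?Q r)"
    have Qr: "?Q r"
      unfolding r_def by (rule GreatestI_nat[of ?Q, OF Q, where b = "length is"]) auto
    have jr: "Suc j \<le> r"
      unfolding r_def by (rule Greatest_le_nat[of ?Q, OF Q, where b = "length is"]) auto
    show "unit_cond m is j"
    proof (cases "Suc j \<le> m")
      case True
      then show ?thesis by (simp add: unit_cond_def)
    next
      case False
      have alt': "is ! (k - 1) \<noteq> is ! k" if "1 \<le> k" "k < length is" for k
        using alt that unfolding alternating_def by (cases k) auto
      have "is ! r < is ! (r - 1)" if r: "r < length is"
      proof (rule ccontr)
        assume "\<not> is ! r < is ! (r - 1)"
        then have "is ! (r - 1) < is ! r" using alt'[of r] r jr by auto
        then have "?Q (Suc r)" using Qr r by (auto simp: less_Suc_eq)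
        then have "Suc r \<le> r"
          unfolding r_def by (rule Greatest_le_nat[of ?Q, where b = "length is"]) auto
        then show False by simp
      qed
      then show ?thesis
        unfolding unit_cond_def using Qr jr False j alt'
        by (intro disjI2 exI[of _ r]) auto
    qed
  qed
  then show ?thesis using eq[of "Suc j"] j by simp
qed

locale m_monotone_algebras =
  fixes m :: nat and sm :: "complex \<Rightarrow> 'a::ring_1 \<Rightarrow> 'a" and st :: "'a \<Rightarrow> 'a"
    and \<phi> :: "'a \<Rightarrow> complex" and Alg :: "'i::linorder \<Rightarrow> 'a set" and u :: "'i \<Rightarrow> 'a"
  assumes m_pos: "1 \<le> m"
    and prob: "nc_prob_space sm st \<phi>"
    and mono: "m_monotone m sm st \<phi> Alg"
    and units: "m_monotone_units m sm st \<phi> Alg u"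
begin

lemma sm_add_left: "sm (c + d) a = sm c a + sm d a"
  and sm_sm: "sm c (sm d a) = sm (c * d) a"
  and sm_one: "sm 1 a = a"
  and sm_mult_left: "sm c a * b = sm c (a * b)"
  and sm_mult_right: "a * sm c b = sm c (a * b)"
  using prob unfolding nc_prob_space_def star_algebra_def by metis+

lemma phi_add: "\<phi> (a + b) = \<phi> a + \<phi> b"
  and phi_sm: "\<phi> (sm c a) = c * \<phi> a"
  and phi_one: "\<phi> 1 = 1"
  using prob unfolding nc_prob_space_def nc_state_def by auto

lemma phi_zero: "\<phi> 0 = 0"
  using phi_add[of 0 0] by simp

lemma phi_sum: "\<phi> (sum f A) = (\<Sum>x\<in>A. \<phi> (f x))"
  by (induction A rule: infinite_finite_induct) (auto simp: phi_add phi_zero)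

lemma
  assumes "a \<in> Alg i" "b \<in> Alg i"
  shows Alg_add: "a + b \<in> Alg i" and Alg_mult: "a * b \<in> Alg i"
  using mono assms unfolding m_monotone_def star_subalgebra_def by blast+

lemma Alg_sm: "a \<in> Alg i \<Longrightarrow> sm c a \<in> Alg i"
  using mono unfolding m_monotone_def star_subalgebra_def by blast

lemma prod_list_sm:
  "prod_list (map (\<lambda>x. sm c (f x)) xs) = sm (c ^ length xs) (prod_list (map f xs))"
  by (induction xs) (simp_all add: sm_one sm_mult_left sm_mult_right sm_sm mult.commute[of c])

lemma unit_in: "u i \<in> Alg i"
  and unit_phi: "\<phi> (u i) = 1"
  using units unfolding m_monotone_units_def by blast+

lemma unit_left: "a \<in> Alg i \<Longrightarrow> u i * a = a"
  and unit_right: "a \<in> Alg i \<Longrightarrow> a * u i = a"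
  using units unfolding m_monotone_units_def by blast+

text \<open>The multiple of \<open>u i\<close>, rather than of the ambient unit, keeps the centred
  part inside \<open>Alg i\<close>, and the term split off is of the form that the unit rule
  evaluates.\<close>

definition cent :: "'i \<Rightarrow> 'a \<Rightarrow> 'a" where
  "cent i a = a + sm (- \<phi> a) (u i)"

lemma cent_in: "a \<in> Alg i \<Longrightarrow> cent i a \<in> Alg i"
  unfolding cent_def by (intro Alg_add Alg_sm[OF unit_in]) auto

lemma phi_cent: "\<phi> (cent i a) = 0"
  by (simp add: cent_def phi_add phi_sm unit_phi)

lemma cent_decomp: "a = cent i a + sm (\<phi> a) (u i)"
proof -
  have "sm (- \<phi> a) (u i) + sm (\<phi> a) (u i) = 0"
    using sm_add_left[of "- \<phi> a" "\<phi> a" "u i"] sm_add_left[of 0 0 "u i"] by simp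
  then show ?thesis by (simp add: cent_def add.assoc)
qed

text \<open>Words carry their indices explicitly, since an element alone does not determine the
  algebra from which it is taken.\<close>

definition valid :: "('i \<times> 'a) list \<Rightarrow> bool" where
  "valid ws \<longleftrightarrow> (\<forall>(i, a)\<in>set ws. a \<in> Alg i)"

definition ev :: "('i \<times> 'a) list \<Rightarrow> 'a" where
  "ev ws = prod_list (map snd ws)"

definition centered :: "('i \<times> 'a) list \<Rightarrow> bool" where
  "centered ws \<longleftrightarrow> (\<forall>(i, a)\<in>set ws. \<phi> a = 0)"

lemma valid_simps [simp]:
  "valid []" "valid ((i, a) # ws) \<longleftrightarrow> a \<in> Alg i \<and> valid ws"
  "valid (ws @ ws') \<longleftrightarrow> valid ws \<and> valid ws'"
  by (auto simp: valid_def)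

lemma centered_simps [simp]:
  "centered []" "centered ((i, a) # ws) \<longleftrightarrow> \<phi> a = 0 \<and> centered ws"
  "centered (ws @ ws') \<longleftrightarrow> centered ws \<and> centered ws'"
  by (auto simp: centered_def)

lemma ev_simps [simp]:
  "ev [] = 1" "ev ((i, a) # ws) = a * ev ws" "ev (ws @ ws') = ev ws * ev ws'"
  by (auto simp: ev_def)

lemma word_adjacent:
  fixes ws :: "('j \<times> 'b) list"
  assumes "\<not> alternating (map fst ws)"
  obtains xs i a b ys where "ws = xs @ (i, a) # (i, b) # ys"
proof -
  obtain ks i js where e: "map fst ws = ks @ i # i # js"
    using not_alternating_first_pair[OF assms] by blast
  then obtain xs zs where ws: "ws = xs @ zs" "map fst zs = i # i # js"
    by (auto simp: map_eq_append_conv)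
  then obtain p q ys where "zs = p # q # ys" "fst p = i" "fst q = i"
    by (auto simp: map_eq_Cons_conv)
  then have "ws = xs @ (i, snd p) # (i, snd q) # ys" using ws by (metis prod.collapse)
  then show thesis using that by blast
qed

lemma centered_alternating_zero:
  assumes "ws \<noteq> []" "valid ws" "centered ws" "alternating (map fst ws)"
  shows "\<phi> (ev ws) = 0"
proof -
  have "\<forall>k<length ws. map snd ws ! k \<in> Alg (map fst ws ! k) \<and> \<phi> (map snd ws ! k) = 0"
    using assms by (auto simp: valid_def centered_def dest!: nth_mem)
  then show ?thesis
    using mono assms unfolding m_monotone_def ev_def
    by (metis length_map map_is_Nil_conv)
qed

text \<open>The defining rule asks for an alternating index word, but the suffix may contain equal
  neighbouring indices. Multiplying such neighbours inside their algebra changes neither the product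
  nor the first index of the suffix, and leads to the alternating case.\<close>

lemma unit_removal:
  assumes "valid xs" "centered xs" "valid ys" "alternating (map fst xs @ [i])"
    and "ys \<noteq> [] \<Longrightarrow> fst (hd ys) \<noteq> i"
  shows "\<phi> (ev xs * u i * ev ys) =
    (if sorted_wrt (<) (drop (m - 1) (map fst xs @ [i])) then \<phi> (ev xs * ev ys) else 0)"
  using assms
proof (induction "length ys" arbitrary: ys rule: less_induct)
  case less
  show ?case
  proof (cases "alternating (map fst ys)")
    case False
    then obtain as k a b bs where ys: "ys = as @ (k, a) # (k, b) # bs"
      by (rule word_adjacent)
    let ?ys = "as @ (k, a * b) # bs"
    have "length ?ys < length ys" "valid ?ys" "?ys \<noteq> [] \<Longrightarrow> fst (hd ?ys) \<noteq> i"
      using less.prems ys by (auto simp: Alg_mult hd_append split: if_splits)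
    then have "\<phi> (ev xs * u i * ev ?ys) =
      (if sorted_wrt (<) (drop (m - 1) (map fst xs @ [i])) then \<phi> (ev xs * ev ?ys) else 0)"
      using less.hyps less.prems by blast
    moreover have "ev ?ys = ev ys" using ys by (simp add: mult.assoc)
    ultimately show ?thesis by simp
  next
    case True
    \<comment> \<open>The \<open>0\<close> is a placeholder: the rule overwrites the entry at this
      position by the unit.\<close>
    let ?ws = "xs @ (i, 0) # ys"
    let ?is = "map fst ?ws" and ?as = "map snd ?ws" and ?j = "length xs"
    have alt: "alternating ?is"
      using less.prems True
      by (cases ys) (auto simp: alternating_iff_successively successively_append_iff)
    have mem: "as ! k \<in> Alg (is ! k)" if "valid zs" "is = map fst zs" "as = map snd zs"
      "k < length zs" for zs "is" as k
      using that by (auto simp: valid_def dest!: nth_mem)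
    have "?as ! k \<in> Alg (?is ! k)" if k: "k < length ?is" "k \<noteq> ?j" for k
    proof (cases "k < ?j")
      case True
      then show ?thesis using mem[of xs _ _ k] less.prems by (simp add: nth_append)
    next
      case False
      then obtain l where l: "k = Suc (?j + l)" using k less_imp_Suc_add[of ?j k] by auto
      then show ?thesis using mem[of ys _ _ l] less.prems k by (simp add: nth_append)
    qed
    moreover have "\<forall>k<?j. \<phi> (?as ! k) = 0"
      using less.prems by (auto simp: centered_def nth_append dest!: nth_mem)
    moreover have "?is ! ?j = i" by (simp add: nth_append)
    ultimately have "\<phi> (prod_list (take ?j ?as) * u i * prod_list (drop (Suc ?j) ?as))
        = (if unit_cond m ?is ?j then \<phi> (prod_list (take ?j ?as) * prod_list (drop (Suc ?j) ?as))
           else 0)"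
      using units alt unfolding m_monotone_units_def
      by (smt (verit) add_less_same_cancel1 length_append length_map length_Cons
          less_add_same_cancel1 zero_less_Suc)
    then show ?thesis
      using unit_cond_iff_sorted[OF m_pos alt, of ?j] by (simp add: ev_def)
  qed
qed

text \<open>The descent step of the inductions below: if \<open>\<phi> a \<noteq> 0\<close>, the
  first word on the right has one uncentred letter less, and the second one is shorter.\<close>

lemma centering_step:
  assumes "valid (xs @ (i, a) # ys)" "centered xs" "alternating (map fst (xs @ (i, a) # ys))"
  shows "\<phi> (ev (xs @ (i, a) # ys)) = \<phi> (ev (xs @ (i, cent i a) # ys)) +
    (if sorted_wrt (<) (drop (m - 1) (map fst xs @ [i])) then \<phi> a * \<phi> (ev (xs @ ys)) else 0)"
proof -
  have "ev (xs @ (i, a) # ys) = ev (xs @ (i, cent i a) # ys) + sm (\<phi> a) (ev xs * u i * ev ys)"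
    by (subst cent_decomp[of a i])
      (simp add: distrib_left distrib_right sm_mult_left sm_mult_right mult.assoc)
  moreover have "\<phi> (ev xs * u i * ev ys) =
    (if sorted_wrt (<) (drop (m - 1) (map fst xs @ [i])) then \<phi> (ev xs * ev ys) else 0)"
    using assms
    by (intro unit_removal)
      (auto simp: alternating_iff_successively successively_append_iff successively_Cons
        hd_map split: if_splits)
  ultimately show ?thesis by (simp add: phi_add phi_sm)
qed

lemma first_noncentered:
  assumes "\<not> centered ws"
  obtains xs i a ys where "ws = xs @ (i, a) # ys" "centered xs" "\<phi> a \<noteq> 0"
proof -
  have "\<exists>x\<in>set ws. \<phi> (snd x) \<noteq> 0" using assms by (force simp: centered_def)
  then obtain xs x ys where "ws = xs @ x # ys" "\<phi> (snd x) \<noteq> 0" "\<forall>y\<in>set xs. \<not> \<phi> (snd y) \<noteq> 0"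
    by (rule split_list_first_propE)
  then show thesis using that[of xs "fst x" "snd x" ys] by (fastforce simp: centered_def)
qed

text \<open>The isolated centred letter survives every reduction. It is never merged, because its
  neighbours carry other indices, and it is never the letter that is centred or deleted. Every word
  reached in the end is nonempty, centred and alternating.\<close>

lemma centered_singleton_zero:
  assumes "valid ws" "(i, a) \<in> set ws" "\<phi> a = 0" "count_list (map fst ws) i = 1"
  shows "\<phi> (ev ws) = 0"
  using assms
\<comment> \<open>The order is lexicographic because merging shortens the word but may create an
  uncentred letter, whereas centring keeps the length.\<close>
proof (induction ws rule: wf_induct_rule[OF wf_measures[of
      "[length, \<lambda>ws. length (filter (\<lambda>x. \<phi> (snd x) \<noteq> 0) ws)]"]])
  case (1 ws)
  show ?case
  proof (cases "alternating (map fst ws)")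
    case False
    then obtain xs k b c ys where ws: "ws = xs @ (k, b) # (k, c) # ys" by (rule word_adjacent)
    let ?ws = "xs @ (k, b * c) # ys"
    have "k \<noteq> i" using "1.prems"(4) ws by auto
    then have "\<phi> (ev ?ws) = 0"
      using "1.prems" ws by (intro "1.IH") (auto simp: Alg_mult)
    then show ?thesis using ws by (simp add: mult.assoc)
  next
    case alt: True
    show ?thesis
    proof (cases "centered ws")
      case True
      then show ?thesis using centered_alternating_zero[of ws] "1.prems" alt by (cases ws) auto
    next
      case False
      then obtain xs k b ys where ws: "ws = xs @ (k, b) # ys" "centered xs" "\<phi> b \<noteq> 0"
        by (rule first_noncentered)
      have mem: "(i, a) \<in> set xs \<union> set ys" using "1.prems" ws by auto
      then have "i \<in> set (map fst (xs @ ys))" by force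
      then have "k \<noteq> i" using "1.prems"(4) ws count_notin[of i "map fst xs"]
          count_list_0_iff[of "map fst xs" i] count_list_0_iff[of "map fst ys" i] by auto
      have "\<phi> (ev (xs @ (k, cent k b) # ys)) = 0"
        using "1.prems" ws mem \<open>k \<noteq> i\<close> by (intro "1.IH") (auto simp: cent_in phi_cent)
      moreover have "\<phi> (ev (xs @ ys)) = 0"
        using "1.prems" ws mem \<open>k \<noteq> i\<close> by (intro "1.IH") auto
      ultimately show ?thesis
        using centering_step[of xs k b ys] "1.prems" ws alt by simp
    qed
  qed
qed

end

section \<open>Identically distributed variables: uniform bounds and the moment recursion\<close>

locale m_monotone_sequence = m_monotone_algebras m sm st \<phi> Alg u
  for m sm and st :: "'a::ring_1 \<Rightarrow> 'a" and \<phi> and Alg :: "'i::linorder \<Rightarrow> 'a set" and u +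
  fixes X :: "'i \<Rightarrow> 'a"
  assumes X_in: "\<And>i. X i \<in> Alg i"
    and X_moments: "\<And>k i j. \<phi> (X i ^ k) = \<phi> (X j ^ k)"
    and X_mean: "\<And>i. \<phi> (X i) = 0"
    and X_var: "\<And>i. \<phi> (X i ^ 2) = 1"
begin

text \<open>The zeroth power of a variable is the unit of its own algebra, not that of the ambient ring.\<close>

definition X_power :: "nat \<Rightarrow> 'i \<Rightarrow> 'a" where
  "X_power k i = (if k = 0 then u i else X i ^ k)"

text \<open>One polynomial evaluated at all variables simultaneously. The scalar in the third rule
  is common to all indices, so identical distribution makes \<open>\<phi>\<close> constant along
  each family. The set is closed under products and centring, the two operations of the
  reduction.\<close>

inductive_set poly_families :: "('i \<Rightarrow> 'a) set" where
  "X_power k \<in> poly_families"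
| "\<lbrakk>g \<in> poly_families; h \<in> poly_families\<rbrakk> \<Longrightarrow> (\<lambda>i. g i + h i) \<in> poly_families"
| "g \<in> poly_families \<Longrightarrow> (\<lambda>i. sm c (g i)) \<in> poly_families"

lemma X_power_in: "X_power k i \<in> Alg i"
proof -
  have "X i ^ Suc k \<in> Alg i" for k
    by (induction k) (auto intro: X_in Alg_mult)
  then show ?thesis by (cases k) (auto simp: X_power_def unit_in)
qed

lemma X_power_mult: "X_power k i * X_power l i = X_power (k + l) i"
  using unit_left[OF X_power_in[of l i]] unit_right[OF X_power_in[of k i]]
  by (auto simp: X_power_def power_add)

lemma poly_families_in: "g \<in> poly_families \<Longrightarrow> g i \<in> Alg i"
  by (induction rule: poly_families.induct) (auto intro: X_power_in Alg_add Alg_sm)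

lemma poly_families_phi: "g \<in> poly_families \<Longrightarrow> \<phi> (g i) = \<phi> (g j)"
proof (induction rule: poly_families.induct)
  case (1 k)
  then show ?case using X_moments[of i k j] by (simp add: X_power_def unit_phi)
qed (auto simp: phi_add phi_sm)

lemma poly_families_mult:
  assumes "g \<in> poly_families" "h \<in> poly_families"
  shows "(\<lambda>i. g i * h i) \<in> poly_families"
  using assms(1)
proof (induction rule: poly_families.induct)
  case (1 k)
  show ?case
    using assms(2)
    by (induction rule: poly_families.induct)
      (auto simp: X_power_mult distrib_left sm_mult_right intro: poly_families.intros)
qed (auto simp: distrib_right sm_mult_left intro: poly_families.intros)

lemma poly_families_cent:
  assumes "g \<in> poly_families"
  shows "(\<lambda>i. cent i (g i)) \<in> poly_families"
proof -
  fix i0 :: 'i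
  have u: "u \<in> poly_families" using poly_families.intros(1)[of 0] by (simp add: X_power_def[abs_def])
  \<comment> \<open>Membership requires one scalar for all indices; \<open>\<phi> (g i)\<close> is
    therefore read off at an arbitrary fixed index.\<close>
  have "(\<lambda>i. cent i (g i)) = (\<lambda>i. g i + sm (- \<phi> (g i0)) (u i))"
    unfolding cent_def using poly_families_phi[OF assms] by metis
  then show ?thesis using assms u by (auto intro: poly_families.intros)
qed

definition ev_families :: "('i \<Rightarrow> 'a) list \<Rightarrow> 'i list \<Rightarrow> 'a" where
  "ev_families gs is = ev (map2 (\<lambda>g i. (i, g i)) gs is)"

lemma valid_families:
  "set gs \<subseteq> poly_families \<Longrightarrow> valid (map2 (\<lambda>g i. (i, g i)) gs is)"
  by (induction gs "is" rule: list_induct2') (auto simp: poly_families_in)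

text \<open>The induction runs over lists of families, so each step produces only finitely many
  bounds: one for each place of a possible merge, and two from centring. Whether a family is centred
  is tested at an arbitrary index \<open>i0\<close>, since the answer is the same
  everywhere.\<close>

lemma poly_families_bounded:
  assumes "set gs \<subseteq> poly_families"
  shows "\<exists>C. \<forall>is. length is = length gs \<longrightarrow> cmod (\<phi> (ev_families gs is)) \<le> C"
  using assms
proof (induction gs rule: wf_induct_rule[OF wf_measures[of
      "[length, \<lambda>gs. length (filter (\<lambda>g. \<phi> (g i0) \<noteq> 0) gs)]"]])
  case (1 gs)
  let ?bd = "\<lambda>gs C. \<forall>is. length is = length gs \<longrightarrow> cmod (\<phi> (ev_families gs is)) \<le> C"
  \<comment> \<open>For index words that agree at the places \<open>k\<close> and
    \<open>Suc k\<close>, multiplying the two families there leaves the evaluated product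
    unchanged.\<close>
  define merge where "merge k = take k gs @ (\<lambda>i. (gs ! k) i * (gs ! Suc k) i) # drop (k + 2) gs" for k
  have "\<exists>C. ?bd (merge k) C" if "Suc k < length gs" for k
  proof (rule "1.IH")
    show "(merge k, gs) \<in> measures [length, \<lambda>gs. length (filter (\<lambda>g. \<phi> (g i0) \<noteq> 0) gs)]"
      using that by (auto simp: merge_def)
    show "set (merge k) \<subseteq> poly_families"
      using "1.prems" that set_take_subset[of k gs] set_drop_subset[of "k + 2" gs]
      by (auto simp: merge_def intro!: poly_families_mult)
  qed
  then obtain C where C: "\<And>k. Suc k < length gs \<Longrightarrow> ?bd (merge k) (C k)" by metis
  \<comment> \<open>The place of the merge depends on the index word; the sum of all the bounds
    dominates each of them.\<close>
  define C1 where "C1 = (\<Sum>k<length gs. \<bar>C k\<bar>)"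
  have nonalt: "cmod (\<phi> (ev_families gs is)) \<le> C1"
    if len: "length is = length gs" and nalt: "\<not> alternating is" for "is"
  proof -
    obtain k where k: "Suc k < length gs" "is ! k = is ! Suc k"
      using nalt len by (auto simp: alternating_def)
    let ?is = "take k is @ is ! k # drop (k + 2) is"
    have g: "gs = take k gs @ gs ! k # gs ! Suc k # drop (k + 2) gs"
      and i: "is = take k is @ is ! k # is ! k # drop (k + 2) is"
      using k len id_take_nth_drop[of k gs] id_take_nth_drop[of k "is"]
        Cons_nth_drop_Suc[of "Suc k" gs] Cons_nth_drop_Suc[of "Suc k" "is"] by simp_all
    have "ev_families gs is = ev_families (take k gs @ gs ! k # gs ! Suc k # drop (k + 2) gs)
        (take k is @ is ! k # is ! k # drop (k + 2) is)"
      using g i by metis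
    also have "\<dots> = ev_families (merge k) ?is"
      using k len by (simp add: ev_families_def merge_def mult.assoc)
    finally have "cmod (\<phi> (ev_families gs is)) \<le> C k"
      using C[of k] k len by (simp add: merge_def)
    also have "C k \<le> C1"
      unfolding C1_def using k member_le_sum[of k "{..<length gs}" "\<lambda>k. \<bar>C k\<bar>"] by force
    finally show ?thesis .
  qed
  have C1_nonneg: "C1 \<ge> 0" unfolding C1_def by (auto intro: sum_nonneg)
  show ?case
  proof (cases "\<forall>g\<in>set gs. \<phi> (g i0) = 0")
    case True
    \<comment> \<open>The extra \<open>1\<close> covers the empty list, where the value is
      \<open>\<phi> 1 = 1\<close>.\<close>
    have "cmod (\<phi> (ev_families gs is)) \<le> C1 + 1" if len: "length is = length gs" for "is"
    proof (cases "alternating is")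
      case False
      then show ?thesis using nonalt[OF len] by simp
    next
      case alt: True
      let ?ws = "map2 (\<lambda>g i. (i, g i)) gs is"
      have v: "valid ?ws"
        using "1.prems" by (rule valid_families)
      have c: "centered ?ws"
        using "1.prems" True poly_families_phi
        by (auto simp: centered_def dest!: set_zip_leftD) (metis subsetD)
      have f: "map fst ?ws = is" using len by (simp add: comp_def case_prod_unfold)
      show ?thesis
      proof (cases "gs = []")
        case True
        then show ?thesis using C1_nonneg by (simp add: ev_families_def phi_one)
      next
        case False
        then have "?ws \<noteq> []" using len by (cases "is"; cases gs) auto
        then show ?thesis
          using centered_alternating_zero[of ?ws] v c f alt C1_nonneg by (simp add: ev_families_def)
      qed
    qed
    then show ?thesis by blast
  next
    case False
    then obtain xs g ys where gs: "gs = xs @ g # ys" "\<phi> (g i0) \<noteq> 0" "\<forall>g\<in>set xs. \<not> \<phi> (g i0) \<noteq> 0"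
      using split_list_first_prop[of gs "\<lambda>g. \<phi> (g i0) \<noteq> 0"] by auto
    have "\<exists>C. ?bd (xs @ (\<lambda>i. cent i (g i)) # ys) C"
      using "1.prems" gs by (intro "1.IH") (auto simp: phi_cent intro!: poly_families_cent)
    then obtain D where D: "?bd (xs @ (\<lambda>i. cent i (g i)) # ys) D" by blast
    have "\<exists>C. ?bd (xs @ ys) C"
      using "1.prems" gs by (intro "1.IH") auto
    then obtain E where E: "?bd (xs @ ys) E" by blast
    have "cmod (\<phi> (ev_families gs is)) \<le> C1 + (\<bar>D\<bar> + cmod (\<phi> (g i0)) * \<bar>E\<bar>)"
      if len: "length is = length gs" for "is"
    proof (cases "alternating is")
      case False
      then show ?thesis using nonalt[OF len] by (simp add: add_increasing2)
    next
      case alt: True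
      define as where "as = take (length xs) is"
      define i where "i = is ! length xs"
      define bs where "bs = drop (Suc (length xs)) is"
      have "is": "is = as @ i # bs"
        using len gs id_take_nth_drop[of "length xs" "is"] by (simp add: as_def i_def bs_def)
      have l: "length as = length xs" "length bs = length ys"
        using len gs by (auto simp: as_def bs_def)
      let ?xs = "map2 (\<lambda>g i. (i, g i)) xs as" and ?ys = "map2 (\<lambda>g i. (i, g i)) ys bs"
      have "valid (?xs @ (i, g i) # ?ys)"
        using "1.prems" gs by (auto intro: valid_families poly_families_in)
      moreover have "centered ?xs"
        using "1.prems" gs poly_families_phi
        by (auto simp: centered_def dest!: set_zip_leftD) (metis subsetD)
      moreover have "map fst (?xs @ (i, g i) # ?ys) = is"
        using l by (simp add: "is" comp_def case_prod_unfold)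
      ultimately have "\<phi> (ev_families gs is) =
          \<phi> (ev_families (xs @ (\<lambda>i. cent i (g i)) # ys) is) +
          (if sorted_wrt (<) (drop (m - 1) (map fst ?xs @ [i]))
            then \<phi> (g i) * \<phi> (ev_families (xs @ ys) (as @ bs)) else 0)"
        using centering_step[of ?xs i "g i" ?ys] l alt by (simp add: ev_families_def gs(1) "is")
      also have "cmod \<dots> \<le> \<bar>D\<bar> + cmod (\<phi> (g i)) * \<bar>E\<bar>"
      proof (rule norm_triangle_le, rule add_mono)
        show "cmod (\<phi> (ev_families (xs @ (\<lambda>i. cent i (g i)) # ys) is)) \<le> \<bar>D\<bar>"
          using D[rule_format, of "is"] len gs(1) by simp
        have "cmod (\<phi> (ev_families (xs @ ys) (as @ bs))) \<le> \<bar>E\<bar>"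
          using E[rule_format, of "as @ bs"] l by simp
        then show "cmod (if sorted_wrt (<) (drop (m - 1) (map fst ?xs @ [i]))
            then \<phi> (g i) * \<phi> (ev_families (xs @ ys) (as @ bs)) else 0) \<le> cmod (\<phi> (g i)) * \<bar>E\<bar>"
          by (simp add: norm_mult mult_left_mono)
      qed
      also have "\<phi> (g i) = \<phi> (g i0)"
        using "1.prems" gs by (intro poly_families_phi) auto
      finally show ?thesis using C1_nonneg by simp
    qed
    then show ?thesis by blast
  qed
qed

lemma moments_bounded:
  "\<exists>C. \<forall>is. length is = n \<longrightarrow> cmod (\<phi> (prod_list (map X is))) \<le> C"
proof -
  have X: "X \<in> poly_families"
    using poly_families.intros(1)[of 1] by (simp add: X_power_def[abs_def])
  have "ev_families (replicate n X) is = prod_list (map X is)" if "length is = n" for "is"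
    using that by (induction "is" arbitrary: n) (auto simp: ev_families_def)
  then show ?thesis
    using poly_families_bounded[of "replicate n X"] X by (auto simp: set_replicate_conv_if)
qed

lemma ev_X_word: "ev (map (\<lambda>i. (i, X i)) w) = prod_list (map X w)"
  by (simp add: ev_def comp_def)

lemma valid_X_word: "valid (map (\<lambda>i. (i, X i)) w)"
  by (auto simp: valid_def X_in)

lemma centered_X_word: "centered (map (\<lambda>i. (i, X i)) w)"
  by (auto simp: centered_def X_mean)

lemma moment_singleton_zero:
  assumes "count_list w i = 1"
  shows "\<phi> (prod_list (map X w)) = 0"
proof -
  have "i \<in> set w" using assms by (metis count_list_0_iff zero_neq_one)
  then show ?thesis
    using centered_singleton_zero[of "map (\<lambda>i. (i, X i)) w" i "X i"] assms
    by (simp add: valid_X_word X_mean ev_X_word[symmetric] comp_def)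
qed

lemma moment_alternating_zero:
  assumes "w \<noteq> []" "alternating w"
  shows "\<phi> (prod_list (map X w)) = 0"
  using centered_alternating_zero[of "map (\<lambda>i. (i, X i)) w"] assms
  by (simp add: valid_X_word centered_X_word ev_X_word comp_def)

text \<open>Unit variance splits \<open>X i ^ 2\<close> into its centred part plus
  \<open>u i\<close>. As \<open>i\<close> occurs nowhere else, the centred part is an isolated
  centred letter and contributes nothing; the rest is the unit rule.\<close>

lemma moment_adjacent_pair:
  assumes "alternating (xs @ [i])" "i \<notin> set xs" "i \<notin> set ys"
  shows "\<phi> (prod_list (map X (xs @ i # i # ys))) =
    (if sorted_wrt (<) (drop (m - 1) (xs @ [i])) then \<phi> (prod_list (map X (xs @ ys))) else 0)"
proof -
  let ?w = "map (\<lambda>i. (i, X i))"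
  let ?c = "cent i (X i ^ 2)"
  have X2: "X i ^ 2 \<in> Alg i" using X_in by (simp add: power2_eq_square Alg_mult)
  have "\<phi> (ev (?w xs @ (i, ?c) # ?w ys)) = 0"
    using assms X2
    by (intro centered_singleton_zero[of _ i ?c])
      (auto simp: valid_X_word cent_in phi_cent comp_def)
  then have *: "\<phi> (ev (?w xs) * ?c * ev (?w ys)) = 0" by (simp add: mult.assoc)
  have "prod_list (map X (xs @ i # i # ys)) = ev (?w xs) * (X i ^ 2) * ev (?w ys)"
    by (simp add: ev_X_word power2_eq_square mult.assoc)
  also have "\<dots> = ev (?w xs) * ?c * ev (?w ys) + ev (?w xs) * u i * ev (?w ys)"
    by (subst cent_decomp[of _ i]) (simp add: X_var sm_one distrib_left distrib_right)
  finally have "\<phi> (prod_list (map X (xs @ i # i # ys))) = \<phi> (ev (?w xs) * u i * ev (?w ys))"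
    using * by (simp add: phi_add)
  also have "\<dots> = (if sorted_wrt (<) (drop (m - 1) (map fst (?w xs) @ [i]))
      then \<phi> (ev (?w xs) * ev (?w ys)) else 0)"
    using assms
    by (intro unit_removal) (auto simp: valid_X_word centered_X_word comp_def hd_map)
  finally show ?thesis by (simp add: ev_X_word comp_def)
qed

end

section \<open>Pair words\<close>

definition letter_positions :: "'i list \<Rightarrow> 'i \<Rightarrow> nat set" where
  "letter_positions w a = {p. p < length w \<and> w ! p = a}"

definition pair_word :: "'i list \<Rightarrow> bool" where
  "pair_word w \<longleftrightarrow> (\<forall>a\<in>set w. count_list w a = 2)"

definition crossing_free :: "'i list \<Rightarrow> bool" where
  "crossing_free w \<longleftrightarrow> (\<forall>s r s' r'. s < r \<and> r < s' \<and> s' < r' \<and> r' < length w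
      \<and> w ! s = w ! s' \<and> w ! r = w ! r' \<longrightarrow> w ! s = w ! r)"

text \<open>The counterpart of \<open>inner\<close> with blocks named by letters. That
  \<open>p\<close> and \<open>q\<close> are neighbours inside the block is left out: it is automatic
  once every letter occurs exactly twice.\<close>

definition encloses :: "'i list \<Rightarrow> 'i \<Rightarrow> 'i \<Rightarrow> bool" where
  "encloses w a b \<longleftrightarrow> (\<exists>p q. p < q \<and> q < length w \<and> w ! p = a \<and> w ! q = a
      \<and> (\<forall>s<length w. w ! s = b \<longrightarrow> p < s \<and> s < q))"

definition word_depth :: "'i list \<Rightarrow> 'i \<Rightarrow> nat" where
  "word_depth w b = Suc (card {a \<in> set w. encloses w a b})"

definition depth_ordered :: "nat \<Rightarrow> 'i::linorder list \<Rightarrow> bool" where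
  "depth_ordered m w \<longleftrightarrow> (\<forall>a\<in>set w. \<forall>b\<in>set w. m \<le> word_depth w a \<and> encloses w a b \<longrightarrow> a < b)"

lemma count_list_eq_card: "count_list w a = card (letter_positions w a)"
  unfolding letter_positions_def count_list_eq_length_filter length_filter_conv_card
  by (simp add: eq_commute)

lemma pair_word_partner:
  assumes "pair_word w" "p < length w"
  obtains t where "t < length w" "t \<noteq> p" "w ! t = w ! p"
    "\<And>s. s < length w \<Longrightarrow> w ! s = w ! p \<Longrightarrow> s = p \<or> s = t"
proof -
  have "card (letter_positions w (w ! p)) = 2"
    using assms by (auto simp: pair_word_def count_list_eq_card)
  then obtain a b where ab: "letter_positions w (w ! p) = {a, b}" "a \<noteq> b"
    by (auto simp: card_2_iff)
  have "p \<in> {a, b}" using assms by (auto simp: ab(1)[symmetric] letter_positions_def)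
  then obtain t where t: "letter_positions w (w ! p) = {p, t}" "t \<noteq> p" using ab by auto
  show thesis
    using that[of t] t by (auto simp: letter_positions_def set_eq_iff)
qed

text \<open>Between two equal letters, the partner of the next letter stays inside; descending along
  such pairs ends at an adjacent one.\<close>

lemma crossing_free_adjacent:
  assumes "pair_word w" "crossing_free w"
  shows "p < q \<Longrightarrow> q < length w \<Longrightarrow> w ! p = w ! q \<Longrightarrow> \<exists>k\<ge>p. k < q \<and> w ! k = w ! Suc k"
proof (induction "q - p" arbitrary: p q rule: less_induct)
  case less
  show ?case
  proof (cases "w ! Suc p = w ! p")
    case True
    then show ?thesis using less.prems by (intro exI[of _ p]) auto
  next
    case False
    have ne: "Suc p \<noteq> q" using False less.prems by auto
    then have lt: "Suc p < q" using less.prems by simp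
    obtain t where t: "t < length w" "t \<noteq> Suc p" "w ! t = w ! Suc p"
      using pair_word_partner[OF assms(1), of "Suc p"] lt less.prems by auto
    have "t \<noteq> p" "t \<noteq> q" using t False less.prems by auto
    moreover have "\<not> t < p"
    proof
      assume "t < p"
      then have "w ! t = w ! p"
        using assms(2)[unfolded crossing_free_def, rule_format, of t p "Suc p" q] lt less.prems t by auto
      then show False using t False by simp
    qed
    moreover have "\<not> q < t"
    proof
      assume "q < t"
      then have "w ! p = w ! Suc p"
        using assms(2)[unfolded crossing_free_def, rule_format, of p "Suc p" q t] lt less.prems t by auto
      then show False using False by simp
    qed
    ultimately have "Suc p < t" "t < q" using t by auto
    moreover have "t - Suc p < q - p" using calculation by auto
    ultimately obtain k where "k \<ge> Suc p" "k < t" "w ! k = w ! Suc k"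
      using less.hyps[of t "Suc p"] t by auto
    then show ?thesis using \<open>t < q\<close> by (intro exI[of _ k]) auto
  qed
qed

text \<open>Without a crossing, the first letter and its partner would have an equal adjacent pair
  between them. This settles the words from which no pair can be removed.\<close>

lemma alternating_pair_word_crossing:
  assumes "pair_word w" "alternating w" "w \<noteq> []"
  shows "\<not> crossing_free w"
proof
  assume cf: "crossing_free w"
  obtain t where t: "t < length w" "t \<noteq> 0" "w ! t = w ! 0"
    using pair_word_partner[OF assms(1), of 0] assms(3) by auto
  then obtain k where "k < t" "w ! k = w ! Suc k"
    using crossing_free_adjacent[OF assms(1) cf, of 0 t] by auto
  then show False using assms(2) t by (auto simp: alternating_def)
qed

text \<open>Embeds the positions of a word into those of the word with two letters inserted at
  \<open>d\<close>. The map is strictly increasing, so crossings and enclosures can be carried along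
  it.\<close>

definition shift2 :: "nat \<Rightarrow> nat \<Rightarrow> nat" where
  "shift2 d p = (if p < d then p else p + 2)"

lemma shift2_less_iff [simp]: "shift2 d p < shift2 d q \<longleftrightarrow> p < q"
  by (auto simp: shift2_def)

locale adjacent_pair =
  fixes xs :: "'i list" and i :: 'i and ys :: "'i list"
  assumes fresh: "i \<notin> set xs" "i \<notin> set ys"
begin

abbreviation "w \<equiv> xs @ i # i # ys"
abbreviation "w' \<equiv> xs @ ys"
abbreviation "h \<equiv> shift2 (length xs)"

lemma nth_h [simp]: "p < length w' \<Longrightarrow> w ! h p = w' ! p"
  by (auto simp: shift2_def nth_append)

lemma h_less_length [simp]: "h p < Suc (Suc (length xs + length ys)) \<longleftrightarrow> p < length xs + length ys"
  by (auto simp: shift2_def)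

lemma nth_eq_i: "q < length w \<Longrightarrow> w ! q = i \<longleftrightarrow> q = length xs \<or> q = Suc (length xs)"
  using fresh by (auto simp: nth_append nth_Cons' in_set_conv_nth)

lemma position_cases:
  assumes "q < length w" "w ! q \<noteq> i"
  obtains p where "p < length w'" "q = h p"
proof -
  have "q \<noteq> length xs" "q \<noteq> Suc (length xs)" using assms by (auto simp: nth_append)
  then consider "q < length xs" | "q \<ge> length xs + 2" by linarith
  then show thesis
  proof cases
    case 1
    then show ?thesis using that[of q] by (simp add: shift2_def)
  next
    case 2
    then have "\<not> q - 2 < length xs" "q = q - 2 + 2" by linarith+
    then have "q = h (q - 2)" unfolding shift2_def by presburger
    then show ?thesis using that[of "q - 2"] assms 2 by simp
  qed
qed

lemma pair_word_remove: "pair_word w \<longleftrightarrow> pair_word w'"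
proof -
  have "count_list w a = count_list w' a" if "a \<noteq> i" for a using that by simp
  moreover have "count_list w i = 2" using fresh by simp
  ultimately show ?thesis unfolding pair_word_def using fresh by auto
qed

lemma crossing_free_remove: "crossing_free w \<longleftrightarrow> crossing_free w'"
proof
  assume cf: "crossing_free w"
  show "crossing_free w'"
    unfolding crossing_free_def
  proof (intro allI impI)
    fix s r s' r'
    assume *: "s < r \<and> r < s' \<and> s' < r' \<and> r' < length w' \<and> w' ! s = w' ! s' \<and> w' ! r = w' ! r'"
    then have "h s < h r \<and> h r < h s' \<and> h s' < h r' \<and> h r' < length w
        \<and> w ! h s = w ! h s' \<and> w ! h r = w ! h r'" by simp
    then have "w ! h s = w ! h r" using cf unfolding crossing_free_def by blast
    then show "w' ! s = w' ! r" using * by simp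
  qed
next
  assume cf: "crossing_free w'"
  show "crossing_free w"
    unfolding crossing_free_def
  proof (intro allI impI)
    fix s r s' r'
    assume *: "s < r \<and> r < s' \<and> s' < r' \<and> r' < length w \<and> w ! s = w ! s' \<and> w ! r = w ! r'"
    then have lt: "s < length w" "r < length w" "s' < length w" "r' < length w" by linarith+
    \<comment> \<open>The two positions of \<open>i\<close> are adjacent and leave no room for a
      position strictly between them, so \<open>i\<close> takes part in no crossing.\<close>
    have "w ! s \<noteq> i" using nth_eq_i[OF lt(1)] nth_eq_i[OF lt(3)] * by auto
    have "w ! r \<noteq> i" using nth_eq_i[OF lt(2)] nth_eq_i[OF lt(4)] * by auto
    have "w ! s' \<noteq> i" "w ! r' \<noteq> i" using * \<open>w ! s \<noteq> i\<close> \<open>w ! r \<noteq> i\<close> by auto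
    obtain s0 where s0: "s0 < length w'" "s = h s0"
      using position_cases[OF lt(1) \<open>w ! s \<noteq> i\<close>] .
    obtain r0 where r0: "r0 < length w'" "r = h r0"
      using position_cases[OF lt(2) \<open>w ! r \<noteq> i\<close>] .
    obtain s1 where s1: "s1 < length w'" "s' = h s1"
      using position_cases[OF lt(3) \<open>w ! s' \<noteq> i\<close>] .
    obtain r1 where r1: "r1 < length w'" "r' = h r1"
      using position_cases[OF lt(4) \<open>w ! r' \<noteq> i\<close>] .
    have "s0 < r0 \<and> r0 < s1 \<and> s1 < r1 \<and> r1 < length w' \<and> w' ! s0 = w' ! s1 \<and> w' ! r0 = w' ! r1"
      using * s0 r0 s1 r1 nth_h[OF s0(1)] nth_h[OF r0(1)] nth_h[OF s1(1)] nth_h[OF r1(1)]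
      by (auto simp del: nth_h)
    then have "w' ! s0 = w' ! r0" using cf unfolding crossing_free_def by blast
    then show "w ! s = w ! r" using s0 r0 by simp
  qed
qed

lemma encloses_remove:
  assumes "a \<noteq> i" "b \<noteq> i"
  shows "encloses w a b \<longleftrightarrow> encloses w' a b"
proof
  assume "encloses w a b"
  then obtain p q where pq: "p < q" "q < length w" "w ! p = a" "w ! q = a"
    "\<And>s. s < length w \<Longrightarrow> w ! s = b \<Longrightarrow> p < s \<and> s < q"
    unfolding encloses_def by blast
  obtain p0 where p0: "p0 < length w'" "p = h p0" using position_cases[of p] pq assms by auto
  obtain q0 where q0: "q0 < length w'" "q = h q0" using position_cases[of q] pq assms by auto
  have "p0 < s \<and> s < q0" if "s < length w'" "w' ! s = b" for s
    using pq(5)[of "h s"] that p0 q0 by simp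
  then show "encloses w' a b"
    unfolding encloses_def using pq p0 q0 by (intro exI[of _ p0] exI[of _ q0]) auto
next
  assume "encloses w' a b"
  then obtain p q where pq: "p < q" "q < length w'" "w' ! p = a" "w' ! q = a"
    "\<And>s. s < length w' \<Longrightarrow> w' ! s = b \<Longrightarrow> p < s \<and> s < q"
    unfolding encloses_def by blast
  have "h p < s \<and> s < h q" if s: "s < length w" "w ! s = b" for s
  proof -
    obtain s0 where s0: "s0 < length w'" "s = h s0" using position_cases[of s] s assms by auto
    then show ?thesis using pq(5)[of s0] s by simp
  qed
  then show "encloses w a b"
    unfolding encloses_def using pq by (intro exI[of _ "h p"] exI[of _ "h q"]) auto
qed

text \<open>Nothing fits between two adjacent positions. The letter \<open>b\<close> must occur,
  since otherwise the condition on its positions would hold vacuously.\<close>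

lemma not_encloses_i:
  assumes "b \<in> set w"
  shows "\<not> encloses w i b"
proof
  assume "encloses w i b"
  then obtain p q where pq: "p < q" "q < length w" "w ! p = i" "w ! q = i"
    "\<And>s. s < length w \<Longrightarrow> w ! s = b \<Longrightarrow> p < s \<and> s < q"
    unfolding encloses_def by blast
  then have "q = Suc p" using nth_eq_i[of p] nth_eq_i[of q] by auto
  moreover obtain s where "s < length w" "w ! s = b" using assms by (metis in_set_conv_nth)
  ultimately show False using pq(5)[of s] by auto
qed

lemma encloses_i_iff:
  assumes "a \<noteq> i"
  shows "encloses w a i \<longleftrightarrow> a \<in> set xs \<and> a \<in> set ys"
proof
  assume "encloses w a i"
  then obtain p q where pq: "p < q" "q < length w" "w ! p = a" "w ! q = a"
    "\<And>s. s < length w \<Longrightarrow> w ! s = i \<Longrightarrow> p < s \<and> s < q"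
    unfolding encloses_def by blast
  have "p < length xs" "Suc (length xs) < q"
    using pq(5)[of "length xs"] pq(5)[of "Suc (length xs)"] by (auto simp: nth_append)
  then have "xs ! p = a" "ys ! (q - (length xs + 2)) = a" "q - (length xs + 2) < length ys"
    using pq(2-4) by (auto simp: nth_append nth_Cons')
  then show "a \<in> set xs \<and> a \<in> set ys"
    using \<open>p < length xs\<close> nth_mem[of p xs] nth_mem[of "q - (length xs + 2)" ys] by simp
next
  assume "a \<in> set xs \<and> a \<in> set ys"
  then obtain p q where pq: "p < length xs" "xs ! p = a" "q < length ys" "ys ! q = a"
    by (auto simp: in_set_conv_nth)
  then show "encloses w a i"
    unfolding encloses_def
    using nth_eq_i by (intro exI[of _ p] exI[of _ "length xs + 2 + q"]) (auto simp: nth_append)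
qed

text \<open>The deleted pair encloses no letter, so it contributes to no depth.\<close>

lemma word_depth_remove:
  assumes "b \<in> set w'"
  shows "word_depth w b = word_depth w' b"
proof -
  have "b \<noteq> i" using assms fresh by auto
  have "encloses w a b \<longleftrightarrow> encloses w' a b" if "a \<in> set w'" for a
    using encloses_remove[of a b] \<open>b \<noteq> i\<close> that fresh by auto
  then have "{a \<in> set w. encloses w a b} = {a \<in> set w'. encloses w' a b}"
    using not_encloses_i[of b] assms by auto
  then show ?thesis unfolding word_depth_def by simp
qed

end

text \<open>A repetition inside the alternating prefix would force an adjacent equal pair there, so
  all partners of prefix letters lie in \<open>ys\<close>. Absence of crossings makes these partners
  appear in reverse order: the prefix letters are nested, each enclosed exactly by its
  predecessors.\<close>

lemma crossing_free_prefix: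
  assumes pw: "pair_word (xs @ ys)" and cf: "crossing_free (xs @ ys)" and alt: "alternating xs"
  shows distinct_prefix: "distinct xs" and prefix_closes: "set xs \<subseteq> set ys"
    and prefix_enclosed: "k < length xs \<Longrightarrow>
      {a \<in> set (xs @ ys). encloses (xs @ ys) a (xs ! k)} = set (take k xs)"
proof -
  let ?w = "xs @ ys"
  have neq: "xs ! p \<noteq> xs ! q" if pq: "p < q" "q < length xs" for p q
  proof
    assume "xs ! p = xs ! q"
    then have "?w ! p = ?w ! q" using pq by (simp add: nth_append)
    then obtain k where "k < q" "?w ! k = ?w ! Suc k"
      using crossing_free_adjacent[OF pw cf, of p q] pq by auto
    then show False using alt pq by (auto simp: alternating_def nth_append split: if_splits)
  qed
  show dist: "distinct xs"
    unfolding distinct_conv_nth using neq by (metis nat_neq_iff)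
  have partner: "\<exists>t. length xs \<le> t \<and> t < length ?w \<and> ?w ! t = xs ! k \<and>
      (\<forall>s<length ?w. ?w ! s = xs ! k \<longrightarrow> s = k \<or> s = t)" if k: "k < length xs" for k
  proof -
    obtain t where t: "t < length ?w" "t \<noteq> k" "?w ! t = ?w ! k"
      "\<And>s. s < length ?w \<Longrightarrow> ?w ! s = ?w ! k \<Longrightarrow> s = k \<or> s = t"
      using pair_word_partner[OF pw, of k] k by auto
    have "length xs \<le> t"
    proof (rule ccontr)
      assume "\<not> length xs \<le> t"
      then have "xs ! t = xs ! k" using t k by (simp add: nth_append)
      then show False using dist t k \<open>\<not> length xs \<le> t\<close> by (auto simp: nth_eq_iff_index_eq)
    qed
    then show ?thesis using t k by (intro exI[of _ t]) (auto simp: nth_append)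
  qed
  show "set xs \<subseteq> set ys"
  proof
    fix a assume "a \<in> set xs"
    then obtain k where k: "k < length xs" "xs ! k = a" by (auto simp: in_set_conv_nth)
    then obtain t where "length xs \<le> t" "t < length ?w" "?w ! t = a" using partner by blast
    then show "a \<in> set ys" by (auto simp: nth_append)
  qed
  show "{a \<in> set ?w. encloses ?w a (xs ! k)} = set (take k xs)" if k: "k < length xs"
  proof (intro set_eqI iffI)
    fix a assume "a \<in> {a \<in> set ?w. encloses ?w a (xs ! k)}"
    then obtain p q where pq: "?w ! p = a"
      "\<And>s. s < length ?w \<Longrightarrow> ?w ! s = xs ! k \<Longrightarrow> p < s \<and> s < q"
      unfolding encloses_def by blast
    have "p < k" using pq(2)[of k] k by (simp add: nth_append)
    then have "take k xs ! p = a" "p < length (take k xs)" using k pq(1) by (auto simp: nth_append)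
    then show "a \<in> set (take k xs)" using nth_mem by blast
  next
    fix a assume "a \<in> set (take k xs)"
    then obtain l where l: "l < k" "xs ! l = a" using k by (auto simp: in_set_conv_nth)
    obtain t where t: "length xs \<le> t" "t < length ?w" "?w ! t = xs ! l"
      using partner[of l] l k by auto
    obtain t' where t': "length xs \<le> t'" "t' < length ?w" "?w ! t' = xs ! k"
      "\<forall>s<length ?w. ?w ! s = xs ! k \<longrightarrow> s = k \<or> s = t'"
      using partner[of k] k by auto
    have ne: "xs ! l \<noteq> xs ! k" using neq[of l k] l k by simp
    have "\<not> t < t'"
    proof
      assume "t < t'"
      then have "l < k \<and> k < t \<and> t < t' \<and> t' < length ?w \<and> ?w ! l = ?w ! t \<and> ?w ! k = ?w ! t'"
        using l k t t' by (simp add: nth_append)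
      then have "?w ! l = ?w ! k" using cf unfolding crossing_free_def by blast
      then show False using ne l k by (simp add: nth_append)
    qed
    then have "t' < t" using t t' ne by (metis nat_neq_iff)
    have "encloses ?w a (xs ! k)"
      unfolding encloses_def
      using l k t t' \<open>t' < t\<close>
      by (intro exI[of _ l] exI[of _ t]) (auto simp: nth_append split: if_splits)
    then show "a \<in> {a \<in> set ?w. encloses ?w a (xs ! k)}" using l k by auto
  qed
qed

text \<open>The prefix letter at position \<open>k\<close> (counted from 0) has depth
  \<open>Suc k\<close>, so depth at least \<open>m\<close> selects exactly
  \<open>drop (m - 1) xs\<close>. These letters enclose one another in order, hence they already
  increase when the shorter word is depth ordered; the removed pair only adds the demand that they
  lie below \<open>i\<close>.\<close>

lemma depth_ordered_remove:
  fixes i :: "'i::linorder"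
  assumes m: "1 \<le> m" and pw: "pair_word (xs @ ys)" and cf: "crossing_free (xs @ ys)"
    and alt: "alternating (xs @ [i])" and i: "i \<notin> set xs" "i \<notin> set ys"
  shows "depth_ordered m (xs @ i # i # ys) \<longleftrightarrow>
    depth_ordered m (xs @ ys) \<and> sorted_wrt (<) (drop (m - 1) (xs @ [i]))"
proof -
  interpret adjacent_pair xs i ys using i by unfold_locales
  have altx: "alternating xs"
    using alt by (simp add: alternating_iff_successively successively_append_iff)
  note pre = distinct_prefix[OF pw cf altx] prefix_closes[OF pw cf altx]
    prefix_enclosed[OF pw cf altx]
  have depth: "word_depth w' (xs ! k) = Suc k" if "k < length xs" for k
    using pre(3)[OF that] pre(1) that unfolding word_depth_def
    by (simp add: distinct_card)
  have split: "depth_ordered m w \<longleftrightarrow> depth_ordered m w' \<and>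
      (\<forall>k<length xs. m \<le> Suc k \<longrightarrow> xs ! k < i)" (is "_ \<longleftrightarrow> _ \<and> ?I")
  proof -
    have "depth_ordered m w \<longleftrightarrow> depth_ordered m w' \<and>
        (\<forall>a\<in>set w'. m \<le> word_depth w' a \<and> encloses w a i \<longrightarrow> a < i)"
    proof -
      have s: "set w = insert i (set w')" by auto
      have ne: "a \<noteq> i" if "a \<in> set w'" for a using that i by auto
      have both: "(m \<le> word_depth w a \<and> encloses w a b \<longrightarrow> a < b) \<longleftrightarrow>
          (m \<le> word_depth w' a \<and> encloses w' a b \<longrightarrow> a < b)" if "a \<in> set w'" "b \<in> set w'" for a b
        using encloses_remove[OF ne ne] word_depth_remove that by metis
      have "\<not> encloses w i b" if "b \<in> insert i (set w')" for b
        using not_encloses_i that s by blast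
      then have "depth_ordered m w \<longleftrightarrow>
          (\<forall>a\<in>set w'. \<forall>b\<in>set w'. m \<le> word_depth w a \<and> encloses w a b \<longrightarrow> a < b) \<and>
          (\<forall>a\<in>set w'. m \<le> word_depth w a \<and> encloses w a i \<longrightarrow> a < i)"
        unfolding depth_ordered_def s by blast
      also have "(\<forall>a\<in>set w'. \<forall>b\<in>set w'. m \<le> word_depth w a \<and> encloses w a b \<longrightarrow> a < b) \<longleftrightarrow>
          depth_ordered m w'"
        unfolding depth_ordered_def using both by blast
      also have "(\<forall>a\<in>set w'. m \<le> word_depth w a \<and> encloses w a i \<longrightarrow> a < i) \<longleftrightarrow>
          (\<forall>a\<in>set w'. m \<le> word_depth w' a \<and> encloses w a i \<longrightarrow> a < i)"
        by (rule ball_cong) (simp_all only: word_depth_remove)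
      finally show ?thesis .
    qed
    also have "(\<forall>a\<in>set w'. m \<le> word_depth w' a \<and> encloses w a i \<longrightarrow> a < i) \<longleftrightarrow>
        (\<forall>a\<in>set xs. m \<le> word_depth w' a \<longrightarrow> a < i)"
    proof -
      have "encloses w a i \<longleftrightarrow> a \<in> set xs" if "a \<in> set w'" for a
        using encloses_i_iff[of a] pre(2) i that by auto
      then show ?thesis by auto
    qed
    also have "\<dots> \<longleftrightarrow> ?I"
      using depth by (auto simp: all_set_conv_all_nth)
    finally show ?thesis .
  qed
  have sorted: "sorted_wrt (<) (drop (m - 1) (xs @ [i])) \<longleftrightarrow>
      ?I" if "depth_ordered m w'"
  proof -
    have asc: "\<forall>k l. m \<le> Suc k \<and> k < l \<and> l < length xs \<longrightarrow> xs ! k < xs ! l"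
    proof (intro allI impI)
      fix k l assume kl: "m \<le> Suc k \<and> k < l \<and> l < length xs"
      then have "xs ! k \<in> set (take l xs)" by (auto simp: in_set_conv_nth)
      then have "encloses w' (xs ! k) (xs ! l)" using pre(3)[of l] kl by auto
      then show "xs ! k < xs ! l"
        using that depth[of k] kl unfolding depth_ordered_def by auto
    qed
    have "sorted_wrt (<) (drop (m - 1) (xs @ [i])) \<longleftrightarrow>
        sorted_wrt (<) (drop (m - 1) xs) \<and> (\<forall>a\<in>set (drop (m - 1) xs). a < i)"
      by (cases "m - 1 \<le> length xs") (auto simp: sorted_wrt_append)
    also have "sorted_wrt (<) (drop (m - 1) xs) \<longleftrightarrow> True"
    proof -
      have "xs ! (m - 1 + k) < xs ! (m - 1 + l)" if "k < l" "l < length xs - (m - 1)" for k l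
        using that m by (intro asc[rule_format]) linarith
      then show ?thesis by (auto simp: sorted_wrt_iff_nth_less)
    qed
    also have "(\<forall>a\<in>set (drop (m - 1) xs). a < i) \<longleftrightarrow> ?I"
    proof
      assume L: "\<forall>a\<in>set (drop (m - 1) xs). a < i"
      show ?I
      proof (intro allI impI)
        fix k assume k: "k < length xs" "m \<le> Suc k"
        then have "drop (m - 1) xs ! (k - (m - 1)) = xs ! k" by simp
        then have "xs ! k \<in> set (drop (m - 1) xs)"
          using k nth_mem[of "k - (m - 1)" "drop (m - 1) xs"] by auto
        then show "xs ! k < i" using L by blast
      qed
    next
      assume ?I
      then show "\<forall>a\<in>set (drop (m - 1) xs). a < i" by (auto simp: in_set_conv_nth)
    qed
    finally show ?thesis by simp
  qed
  show ?thesis using split sorted by blast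
qed

context m_monotone_sequence
begin

text \<open>Moment and combinatorial condition obey the same recursion under deletion of the
  leftmost adjacent pair. The recursion stops at the empty word, where both sides are 1, or at a
  nonempty alternating word, where both are 0.\<close>

lemma pair_word_moment:
  assumes "pair_word w"
  shows "\<phi> (prod_list (map X w)) = of_bool (crossing_free w \<and> depth_ordered m w)"
  using assms
proof (induction "length w" arbitrary: w rule: less_induct)
  case less
  show ?case
  proof (cases "w = []")
    case True
    then show ?thesis by (simp add: phi_one crossing_free_def depth_ordered_def)
  next
    case ne: False
    show ?thesis
    proof (cases "alternating w")
      case True
      then show ?thesis
        using moment_alternating_zero[of w] alternating_pair_word_crossing[of w] less.prems ne
        by simp
    next
      case False
      then obtain xs i ys where w: "w = xs @ i # i # ys" and alt: "alternating (xs @ [i])"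
        using not_alternating_first_pair by blast
      have "count_list w i = 2" using less.prems w by (auto simp: pair_word_def)
      then have i: "i \<notin> set xs" "i \<notin> set ys" using w by (auto simp: count_list_0_iff)
      then interpret adjacent_pair xs i ys by unfold_locales
      have pw: "pair_word (xs @ ys)" using pair_word_remove less.prems w by simp
      then have "\<phi> (prod_list (map X (xs @ ys))) =
          of_bool (crossing_free (xs @ ys) \<and> depth_ordered m (xs @ ys))"
        using less.hyps[of "xs @ ys"] w by simp
      then show ?thesis
        using moment_adjacent_pair[OF alt i] crossing_free_remove
          depth_ordered_remove[OF m_pos pw _ alt i]
        unfolding w by auto
    qed
  qed
qed

end

section \<open>The ordered kernel of a word\<close>

text \<open>The ordered kernel: a block is coloured by the rank of its letter, so comparing colours
  is comparing indices.\<close>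

definition word_partition :: "'i::linorder list \<Rightarrow> nat set list" where
  "word_partition w = map (letter_positions w) (sorted_list_of_set (set w))"

lemma length_word_partition [simp]: "length (word_partition w) = card (set w)"
  by (simp add: word_partition_def)

lemma word_partition_nth:
  "r < card (set w) \<Longrightarrow> word_partition w ! r = letter_positions w (sorted_list_of_set (set w) ! r)"
  by (simp add: word_partition_def)

lemma sorted_list_of_set_nth_less_iff:
  assumes "r < card A" "s < card A"
  shows "sorted_list_of_set A ! r < sorted_list_of_set A ! s \<longleftrightarrow> r < s"
proof -
  have "sorted_list_of_set A ! r < sorted_list_of_set A ! s" if "r < s" "s < card A" for r s
    using that sorted_wrt_nth_less[OF strict_sorted_list_of_set[of A]] by simp
  then show ?thesis using assms by (metis less_asym nat_neq_iff)
qed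

lemma sorted_list_of_set_nth_mem:
  "finite A \<Longrightarrow> r < card A \<Longrightarrow> sorted_list_of_set A ! r \<in> A"
  by (metis length_sorted_list_of_set nth_mem set_sorted_list_of_set)

lemma sorted_list_of_set_nth_obtain:
  assumes "finite A" "a \<in> A"
  obtains r where "r < card A" "a = sorted_list_of_set A ! r"
  using assms by (metis in_set_conv_nth length_sorted_list_of_set set_sorted_list_of_set)

lemma sorted_list_of_set_nth_eq_iff:
  "r < card A \<Longrightarrow> s < card A \<Longrightarrow> sorted_list_of_set A ! r = sorted_list_of_set A ! s \<longleftrightarrow> r = s"
  using nth_eq_iff_index_eq[OF distinct_sorted_list_of_set[of A]] by simp

lemma ordered_partition_word: "ordered_partition (length w) (word_partition w)"
  unfolding ordered_partition_def
proof (intro conjI allI impI)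
  fix r assume "r < length (word_partition w)"
  then have r: "r < card (set w)" by simp
  then obtain p where "p < length w" "w ! p = sorted_list_of_set (set w) ! r"
    using sorted_list_of_set_nth_mem[of "set w" r] by (auto simp: in_set_conv_nth)
  then show "word_partition w ! r \<noteq> {}"
    using r by (auto simp: word_partition_nth letter_positions_def)
next
  fix r r' assume "r < length (word_partition w)" "r' < length (word_partition w)" "r \<noteq> r'"
  then show "word_partition w ! r \<inter> word_partition w ! r' = {}"
    by (auto simp: word_partition_nth letter_positions_def sorted_list_of_set_nth_eq_iff)
next
  show "\<Union> (set (word_partition w)) = {..<length w}"
    by (auto simp: word_partition_def letter_positions_def)
qed

lemma non_crossing_word: "non_crossing (word_partition w) \<longleftrightarrow> crossing_free w"
proof
  assume nc: "non_crossing (word_partition w)"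
  show "crossing_free w"
    unfolding crossing_free_def
  proof (intro allI impI, rule ccontr)
    fix s r s' r'
    assume *: "s < r \<and> r < s' \<and> s' < r' \<and> r' < length w \<and> w ! s = w ! s' \<and> w ! r = w ! r'"
      and ne: "w ! s \<noteq> w ! r"
    obtain i where i: "i < card (set w)" "w ! s = sorted_list_of_set (set w) ! i"
      using sorted_list_of_set_nth_obtain[of "set w" "w ! s"] * by auto
    obtain j where j: "j < card (set w)" "w ! r = sorted_list_of_set (set w) ! j"
      using sorted_list_of_set_nth_obtain[of "set w" "w ! r"] * by auto
    have "i \<noteq> j" using i j ne by auto
    moreover have "s \<in> word_partition w ! i" "s' \<in> word_partition w ! i"
      "r \<in> word_partition w ! j" "r' \<in> word_partition w ! j"
      using i j * by (auto simp: word_partition_nth letter_positions_def)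
    ultimately show False using nc i j * unfolding non_crossing_def length_word_partition by blast
  qed
next
  assume cf: "crossing_free w"
  show "non_crossing (word_partition w)"
    unfolding non_crossing_def length_word_partition
  proof clarify
    fix i j s r s' r'
    assume ij: "i < card (set w)" "j < card (set w)" "i \<noteq> j" and
      *: "s < r" "r < s'" "s' < r'" "s \<in> word_partition w ! i" "s' \<in> word_partition w ! i"
      "r \<in> word_partition w ! j" "r' \<in> word_partition w ! j"
    then have "w ! s = w ! r"
      using cf[unfolded crossing_free_def, rule_format, of s r s' r']
      by (auto simp: word_partition_nth letter_positions_def)
    then show False
      using ij * by (auto simp: word_partition_nth letter_positions_def sorted_list_of_set_nth_eq_iff)
  qed
qed

lemma card_blocks_word: "(\<forall>B\<in>set (word_partition w). card B = 2) \<longleftrightarrow> pair_word w"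
  by (auto simp: word_partition_def pair_word_def count_list_eq_card)

lemma inner_word_iff:
  assumes "pair_word w" "j < card (set w)" "i < card (set w)"
  shows "inner (word_partition w) j i \<longleftrightarrow>
    encloses w (sorted_list_of_set (set w) ! j) (sorted_list_of_set (set w) ! i)"
proof -
  let ?a = "sorted_list_of_set (set w) ! j" and ?b = "sorted_list_of_set (set w) ! i"
  have pos: "p \<in> word_partition w ! j \<longleftrightarrow> p < length w \<and> w ! p = ?a"
    "p \<in> word_partition w ! i \<longleftrightarrow> p < length w \<and> w ! p = ?b" for p
    using assms by (auto simp: word_partition_nth letter_positions_def)
  show ?thesis
  proof
    assume "inner (word_partition w) j i"
    then obtain p q where "p \<in> word_partition w ! j" "q \<in> word_partition w ! j" "p < q"
      "\<forall>s\<in>word_partition w ! i. p < s \<and> s < q"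
      unfolding inner_def by blast
    then show "encloses w ?a ?b"
      unfolding encloses_def pos by (intro exI[of _ p] exI[of _ q]) (auto simp: pos)
  next
    assume "encloses w ?a ?b"
    then obtain p q where pq: "p < q" "q < length w" "w ! p = ?a" "w ! q = ?a"
      "\<forall>s<length w. w ! s = ?b \<longrightarrow> p < s \<and> s < q"
      unfolding encloses_def by blast
    then have p: "p < length w" by simp
    obtain t where t: "\<And>s. s < length w \<Longrightarrow> w ! s = ?a \<Longrightarrow> s = p \<or> s = t"
      using pair_word_partner[OF assms(1) p] pq(3) by metis
    have "t = q" using t[of q] pq by auto
    then have "\<forall>x\<in>word_partition w ! j. \<not> (p < x \<and> x < q)"
      using t pos by blast
    then show "inner (word_partition w) j i"
      unfolding inner_def using pq p by (intro bexI[of _ p] bexI[of _ q]) (auto simp: pos)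
  qed
qed

lemma depth_word:
  assumes "pair_word w" "i < card (set w)"
  shows "depth (word_partition w) i = word_depth w (sorted_list_of_set (set w) ! i)"
proof -
  let ?v = "sorted_list_of_set (set w)"
  have "{a \<in> set w. encloses w a (?v ! i)} =
      (!) ?v ` {j. j < length (word_partition w) \<and> inner (word_partition w) j i}"
  proof (intro set_eqI iffI)
    fix a assume a: "a \<in> {a \<in> set w. encloses w a (?v ! i)}"
    then obtain j where "j < card (set w)" "a = ?v ! j"
      using sorted_list_of_set_nth_obtain[of "set w" a] by auto
    then show "a \<in> (!) ?v ` {j. j < length (word_partition w) \<and> inner (word_partition w) j i}"
      using a assms by (simp add: inner_word_iff)
  next
    fix a assume "a \<in> (!) ?v ` {j. j < length (word_partition w) \<and> inner (word_partition w) j i}"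
    then obtain j where "j < card (set w)" "a = ?v ! j" "inner (word_partition w) j i" by auto
    then show "a \<in> {a \<in> set w. encloses w a (?v ! i)}"
      using assms sorted_list_of_set_nth_mem[of "set w" j] by (simp add: inner_word_iff)
  qed
  moreover have "inj_on ((!) ?v) {j. j < length (word_partition w) \<and> inner (word_partition w) j i}"
    by (auto simp: inj_on_def sorted_list_of_set_nth_eq_iff)
  ultimately show ?thesis unfolding depth_def word_depth_def by (simp add: card_image)
qed

lemma word_partition_ONC2_iff:
  "word_partition w \<in> ONC2 (length w) m \<longleftrightarrow> pair_word w \<and> crossing_free w \<and> depth_ordered m w"
proof (cases "pair_word w")
  case False
  then show ?thesis by (auto simp: ONC2_def card_blocks_word)
next
  case True
  let ?v = "sorted_list_of_set (set w)"
  have "depth_ordered m w \<longleftrightarrow> (\<forall>i<card (set w). \<forall>j<card (set w).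
      m \<le> word_depth w (?v ! j) \<and> encloses w (?v ! j) (?v ! i) \<longrightarrow> ?v ! j < ?v ! i)"
    unfolding depth_ordered_def
    using sorted_list_of_set_nth_obtain[of "set w"] sorted_list_of_set_nth_mem[of "set w"]
    by (metis List.finite_set)
  also have "\<dots> \<longleftrightarrow> (\<forall>i<card (set w). \<forall>j<card (set w).
      m \<le> depth (word_partition w) j \<and> inner (word_partition w) j i \<longrightarrow> j < i)"
    using True by (simp add: depth_word inner_word_iff sorted_list_of_set_nth_less_iff)
  finally show ?thesis
    using True by (simp add: ONC2_def ONC_def card_blocks_word non_crossing_word ordered_partition_word)
qed

lemma ordered_partition_distinct:
  assumes "ordered_partition n P"
  shows "distinct P"
  using assms unfolding distinct_conv_nth ordered_partition_def by (metis inf.idem)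

lemma finite_ONC2: "finite (ONC2 n m)"
proof (rule finite_subset)
  show "ONC2 n m \<subseteq> {P. set P \<subseteq> Pow {..<n} \<and> distinct P}"
    by (auto simp: ONC2_def ONC_def ordered_partition_distinct) (auto simp: ordered_partition_def)
  show "finite {P. set P \<subseteq> Pow {..<n} \<and> distinct P}"
    by (intro finite_subset_distinct) auto
qed

section \<open>Counting words\<close>

text \<open>The labels are abstract because the same notion serves twice: with one label per
  position for the expansion of the product, and with one label per block for the count of words
  with a fixed kernel.\<close>

definition choices :: "('g \<Rightarrow> nat set) \<Rightarrow> 'g list \<Rightarrow> nat list set" where
  "choices I gs = {w. list_all2 (\<lambda>x g. x \<in> I g) w gs}"

definition increasing_choices :: "('g \<Rightarrow> nat set) \<Rightarrow> 'g list \<Rightarrow> nat list set" where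
  "increasing_choices I gs = {w \<in> choices I gs. sorted_wrt (<) w}"

lemma mem_choices_iff:
  "w \<in> choices I gs \<longleftrightarrow> length w = length gs \<and> (\<forall>p<length gs. w ! p \<in> I (gs ! p))"
  by (auto simp: choices_def list_all2_conv_all_nth)

lemma choices_Nil [simp]: "choices I [] = {[]}"
  by (auto simp: choices_def)

lemma choices_Cons: "choices I (g # gs) = (\<lambda>(x, w). x # w) ` (I g \<times> choices I gs)"
  by (auto simp: choices_def list_all2_Cons2)

lemma finite_choices: "(\<And>g. finite (I g)) \<Longrightarrow> finite (choices I gs)"
  by (induction gs) (auto simp: choices_Cons)

lemma prod_list_sum_choices:
  fixes X :: "nat \<Rightarrow> 'a::ring_1"
  shows "prod_list (map (\<lambda>g. \<Sum>i\<in>I g. X i) gs) = (\<Sum>w\<in>choices I gs. prod_list (map X w))"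
proof (induction gs)
  case (Cons g gs)
  have inj: "inj_on (\<lambda>(x, w). x # w) (I g \<times> choices I gs)" by (auto simp: inj_on_def)
  have "(\<Sum>w\<in>choices I (g # gs). prod_list (map X w)) =
      (\<Sum>(x, w)\<in>I g \<times> choices I gs. X x * prod_list (map X w))"
    unfolding choices_Cons by (subst sum.reindex[OF inj]) (simp add: case_prod_unfold)
  also have "\<dots> = (\<Sum>x\<in>I g. X x) * (\<Sum>w\<in>choices I gs. prod_list (map X w))"
    by (simp add: sum_product sum.cartesian_product)
  finally show ?case using Cons.IH by simp
qed simp

text \<open>An increasing list drawn from a single set amounts to a subset of it. This is the origin
  of the factorials in the limit.\<close>

lemma card_increasing_choices_replicate:
  assumes "finite (I h)"
  shows "card (increasing_choices I (replicate b h)) = card (I h) choose b"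
proof -
  have "bij_betw set (increasing_choices I (replicate b h)) {A. A \<subseteq> I h \<and> card A = b}"
  proof (rule bij_betw_byWitness[where f' = sorted_list_of_set])
    show "\<forall>w\<in>increasing_choices I (replicate b h). sorted_list_of_set (set w) = w"
      by (auto simp: increasing_choices_def strict_sorted_iff sorted_list_of_set.idem_if_sorted_distinct)
    show "\<forall>A\<in>{A. A \<subseteq> I h \<and> card A = b}. set (sorted_list_of_set A) = A"
      using assms by (auto dest: finite_subset)
    show "set ` increasing_choices I (replicate b h) \<subseteq> {A. A \<subseteq> I h \<and> card A = b}"
      by (auto simp: increasing_choices_def mem_choices_iff strict_sorted_iff distinct_card
          in_set_conv_nth)
    show "sorted_list_of_set ` {A. A \<subseteq> I h \<and> card A = b} \<subseteq> increasing_choices I (replicate b h)"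
    proof clarify
      fix A assume A: "A \<subseteq> I h"
      then have "finite A" using assms finite_subset by blast
      then show "sorted_list_of_set A \<in> increasing_choices I (replicate (card A) h)"
        using A sorted_list_of_set_nth_mem[of A]
        by (auto simp: increasing_choices_def mem_choices_iff)
    qed
  qed
  then have "card (increasing_choices I (replicate b h)) = card {A. A \<subseteq> I h \<and> card A = b}"
    by (rule bij_betw_same_card)
  then show ?thesis using n_subsets[OF assms] by simp
qed

text \<open>When all candidates for the first part lie below those for the second, concatenation
  keeps lists increasing, so the counts multiply. The order of disjoint intervals enters the count
  here.\<close>

lemma card_increasing_choices_append:
  assumes "\<And>g h x y. g \<in> set gs \<Longrightarrow> h \<in> set hs \<Longrightarrow> x \<in> I g \<Longrightarrow> y \<in> I h \<Longrightarrow> x < y"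
  shows "card (increasing_choices I (gs @ hs)) =
    card (increasing_choices I gs) * card (increasing_choices I hs)"
proof -
  have "increasing_choices I (gs @ hs) =
      (\<lambda>(v, w). v @ w) ` (increasing_choices I gs \<times> increasing_choices I hs)"
  proof (intro set_eqI iffI)
    fix z assume "z \<in> increasing_choices I (gs @ hs)"
    then obtain v w where "z = v @ w" "list_all2 (\<lambda>x g. x \<in> I g) v gs"
      "list_all2 (\<lambda>x g. x \<in> I g) w hs" "sorted_wrt (<) (v @ w)"
      by (auto simp: increasing_choices_def choices_def list_all2_append2)
    then show "z \<in> (\<lambda>(v, w). v @ w) ` (increasing_choices I gs \<times> increasing_choices I hs)"
      by (auto simp: increasing_choices_def choices_def sorted_wrt_append)
  next
    fix z assume "z \<in> (\<lambda>(v, w). v @ w) ` (increasing_choices I gs \<times> increasing_choices I hs)"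
    then obtain v w where z: "z = v @ w" and v: "list_all2 (\<lambda>x g. x \<in> I g) v gs"
      and w: "list_all2 (\<lambda>x g. x \<in> I g) w hs" and s: "sorted_wrt (<) v" "sorted_wrt (<) w"
      by (auto simp: increasing_choices_def choices_def)
    have "x < y" if xy: "x \<in> set v" "y \<in> set w" for x y
    proof -
      obtain k where k: "k < length gs" "x \<in> I (gs ! k)"
        using v xy by (metis in_set_conv_nth list_all2_conv_all_nth)
      obtain l where l: "l < length hs" "y \<in> I (hs ! l)"
        using w xy by (metis in_set_conv_nth list_all2_conv_all_nth)
      show ?thesis using assms[of "gs ! k" "hs ! l"] k l by simp
    qed
    then show "z \<in> increasing_choices I (gs @ hs)"
      using z v w s
      by (auto simp: increasing_choices_def choices_def sorted_wrt_append intro: list_all2_appendI)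
  qed
  moreover have "inj_on (\<lambda>(v, w). v @ w) (increasing_choices I gs \<times> increasing_choices I hs)"
    by (auto simp: inj_on_def increasing_choices_def choices_def dest!: list_all2_lengthD)
  ultimately show ?thesis by (simp add: card_image card_cartesian_product)
qed

text \<open>A word with at most \<open>d\<close> distinct letters is a \<open>d\<close>-letter alphabet together with a word in
  \<open>{..<d}\<close>.\<close>

lemma card_few_letters_le:
  "finite {w. length w = n \<and> set w \<subseteq> {..M} \<and> card (set w) \<le> d}" (is "finite ?S")
  "card {w::nat list. length w = n \<and> set w \<subseteq> {..M} \<and> card (set w) \<le> d} \<le> Suc M ^ d * d ^ n"
proof -
  let ?V = "{v. set v \<subseteq> {..M} \<and> length v = d}" and ?C = "{c. set c \<subseteq> {..<d} \<and> length c = n}"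
  have fin: "finite (?V \<times> ?C)" by (simp add: finite_lists_length_eq)
  have sub: "?S \<subseteq> (\<lambda>(v, c). map ((!) v) c) ` (?V \<times> ?C)"
  proof
    fix w assume "w \<in> ?S"
    then have w: "length w = n" "set w \<subseteq> {..M}" "card (set w) \<le> d" by auto
    \<comment> \<open>Padding with \<open>0\<close>, which always lies in \<open>{..M}\<close>,
      brings the alphabet to length exactly \<open>d\<close>.\<close>
    let ?v = "sorted_list_of_set (set w) @ replicate (d - card (set w)) 0"
    have "\<exists>k<d. ?v ! k = a" if a: "a \<in> set w" for a
    proof -
      obtain k where "k < card (set w)" "a = sorted_list_of_set (set w) ! k"
        using sorted_list_of_set_nth_obtain[OF List.finite_set a] by blast
      then show ?thesis using w by (intro exI[of _ k]) (auto simp: nth_append)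
    qed
    then obtain f where f: "\<And>a. a \<in> set w \<Longrightarrow> f a < d \<and> ?v ! f a = a" by metis
    have "?v \<in> ?V" using w by (auto simp: set_replicate_conv_if)
    moreover have "map f w \<in> ?C" using f w by auto
    moreover have "map ((!) ?v) (map f w) = w" using f by (simp add: map_idI)
    ultimately show "w \<in> (\<lambda>(v, c). map ((!) v) c) ` (?V \<times> ?C)"
      by (intro image_eqI[of _ _ "(?v, map f w)"]) auto
  qed
  show "finite ?S" using finite_subset[OF sub] fin by blast
  have "card ?S \<le> card (?V \<times> ?C)" using surj_card_le[OF fin sub] .
  also have "\<dots> = Suc M ^ d * d ^ n"
    by (simp add: card_cartesian_product card_lists_length_eq)
  finally show "card ?S \<le> Suc M ^ d * d ^ n" .
qed

text \<open>Every letter occurs at least twice and some letter at least three times. The resulting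
  strict inequality is what loses against the normalisation by \<open>sqrt N ^ n\<close>.\<close>

lemma no_singleton_few_letters:
  assumes "\<not> pair_word w" "\<And>a. count_list w a \<noteq> 1"
  shows "2 * card (set w) < length w"
proof -
  have ge: "2 \<le> count_list w a" if "a \<in> set w" for a
    using that assms(2)[of a] count_list_0_iff[of w a] by linarith
  obtain b where b: "b \<in> set w" "count_list w b \<noteq> 2" using assms(1) by (auto simp: pair_word_def)
  have "2 * card (set w) = (\<Sum>a\<in>set w. 2)" by simp
  also have "\<dots> < (\<Sum>a\<in>set w. count_list w a)"
    using ge b le_neq_trans[OF ge[of b]] by (intro sum_strict_mono_ex1) (auto intro!: bexI[of _ b])
  also have "\<dots> = length w" by (simp add: sum_count_set)
  finally show ?thesis .
qed

section \<open>Indicator functions and the asymptotics of index intervals\<close>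

lemma chi_eq_iff:
  assumes "in_Theta p" "in_Theta q"
  shows "chi p = chi q \<longleftrightarrow> p = q"
proof
  assume eq: "chi p = chi q"
  have "{fst p<..snd p} = {fst q<..snd q}"
  proof (rule set_eqI)
    fix x show "x \<in> {fst p<..snd p} \<longleftrightarrow> x \<in> {fst q<..snd q}"
      using fun_cong[OF eq, of x] by (auto simp: chi_def indicator_def split: if_splits)
  qed
  then show "p = q"
    using assms Ioc_inj[of "fst p" "snd p" "fst q" "snd q"] by (auto simp: in_Theta_def prod_eq_iff)
qed simp

lemma L2_inner_chi:
  assumes "in_Theta p"
  shows "L2_inner (chi p) (chi p) = snd p - fst p"
proof -
  have "(\<lambda>x. indicator {0..} x * chi p x * chi p x) = (indicator {fst p<..snd p} :: real \<Rightarrow> real)"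
    using assms by (auto simp: chi_def in_Theta_def indicator_def fun_eq_iff)
  then show ?thesis
    unfolding L2_inner_def using assms by (simp add: in_Theta_def)
qed

definition index_interval :: "nat \<Rightarrow> real \<times> real \<Rightarrow> nat set" where
  "index_interval N p = {nat \<lfloor>fst p * real N\<rfloor> + 1 .. nat \<lfloor>snd p * real N\<rfloor>}"

lemma finite_index_interval [simp]: "finite (index_interval N p)"
  by (simp add: index_interval_def)

lemma index_interval_less:
  assumes "snd p \<le> fst q" "x \<in> index_interval N p" "y \<in> index_interval N q"
  shows "x < y"
proof -
  have "nat \<lfloor>snd p * real N\<rfloor> \<le> nat \<lfloor>fst q * real N\<rfloor>"
    using assms(1) by (intro nat_mono floor_mono mult_right_mono) auto
  then show ?thesis using assms(2,3) by (simp add: index_interval_def)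
qed

lemma nat_floor_mult_over_tendsto:
  assumes "0 \<le> t"
  shows "(\<lambda>N. real (nat \<lfloor>t * real N\<rfloor>) / real N) \<longlonglongrightarrow> t"
proof (rule tendsto_sandwich)
  show "(\<lambda>N. t - 1 / real N) \<longlonglongrightarrow> t"
    using tendsto_diff[OF tendsto_const lim_1_over_n, of t] by simp
  show "\<forall>\<^sub>F N in sequentially. t - 1 / real N \<le> real (nat \<lfloor>t * real N\<rfloor>) / real N"
  proof (rule eventually_mono[OF eventually_gt_at_top[of 0]])
    fix N :: nat assume N: "0 < N"
    have "t * real N - 1 \<le> real (nat \<lfloor>t * real N\<rfloor>)" using assms by linarith
    then have "(t * real N - 1) / real N \<le> real (nat \<lfloor>t * real N\<rfloor>) / real N"
      by (rule divide_right_mono) simp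
    then show "t - 1 / real N \<le> real (nat \<lfloor>t * real N\<rfloor>) / real N"
      using N by (simp add: diff_divide_distrib)
  qed
  show "\<forall>\<^sub>F N in sequentially. real (nat \<lfloor>t * real N\<rfloor>) / real N \<le> t"
  proof (rule eventually_mono[OF eventually_gt_at_top[of 0]])
    fix N :: nat assume N: "0 < N"
    have "real (nat \<lfloor>t * real N\<rfloor>) \<le> t * real N" using assms by simp
    then show "real (nat \<lfloor>t * real N\<rfloor>) / real N \<le> t"
      using N by (simp add: field_simps)
  qed
qed auto

lemma card_index_interval_tendsto:
  assumes "in_Theta p"
  shows "(\<lambda>N. real (card (index_interval N p)) / real N) \<longlonglongrightarrow> snd p - fst p"
proof -
  have eq: "real (card (index_interval N p)) / real N =
      real (nat \<lfloor>snd p * real N\<rfloor>) / real N - real (nat \<lfloor>fst p * real N\<rfloor>) / real N" for N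
  proof -
    have "nat \<lfloor>fst p * real N\<rfloor> \<le> nat \<lfloor>snd p * real N\<rfloor>"
      using assms by (intro nat_mono floor_mono mult_right_mono) (auto simp: in_Theta_def)
    then show ?thesis by (simp add: index_interval_def of_nat_diff diff_divide_distrib)
  qed
  show ?thesis
    unfolding eq using assms
    by (intro tendsto_diff nat_floor_mult_over_tendsto) (auto simp: in_Theta_def)
qed

text \<open>The binomial coefficient is a falling product of \<open>b\<close> factors over
  \<open>b!\<close>; after division by \<open>N\<close> each factor tends to \<open>l\<close>,
  because the shifts \<open>i / N\<close> vanish.\<close>

lemma binomial_over_power_tendsto:
  fixes c :: "nat \<Rightarrow> nat"
  assumes "(\<lambda>N. real (c N) / real N) \<longlonglongrightarrow> l"
  shows "(\<lambda>N. real (c N choose b) / real N ^ b) \<longlonglongrightarrow> l ^ b / fact b"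
proof -
  have eq: "real (c N choose b) / real N ^ b = (\<Prod>i<b. real (c N) / real N - real i / real N) / fact b" for N
    by (simp add: binomial_gbinomial gbinomial_prod_rev prod_dividef atLeast0LessThan
        diff_divide_distrib[symmetric])
  have "(\<lambda>N. real i / real N) \<longlonglongrightarrow> 0" for i
    by (rule lim_const_over_n)
  then have "(\<lambda>N. (\<Prod>i<b. real (c N) / real N - real i / real N) / fact b)
      \<longlonglongrightarrow> (\<Prod>i<b. l - 0) / fact b"
    by (intro tendsto_divide tendsto_prod tendsto_diff assms tendsto_const) auto
  then show ?thesis unfolding eq by simp
qed

text \<open>The leading run of equal labels is split off. Its interval lies before all later ones,
  so the count is a binomial coefficient times the count for the remaining labels.\<close>

lemma increasing_choices_tendsto:
  assumes "sorted_wrt theta_le gs" "\<forall>g\<in>set gs. in_Theta g"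
  shows "(\<lambda>N. real (card (increasing_choices (index_interval N) gs)) / real N ^ length gs)
    \<longlonglongrightarrow> prod_list (map (\<lambda>g. snd g - fst g) gs) / (\<Prod>g\<in>set gs. fact (count_list gs g))"
  using assms
proof (induction "length gs" arbitrary: gs rule: less_induct)
  case less
  show ?case
  proof (cases gs)
    case Nil
    have "increasing_choices I [] = {[]}" for I :: "real \<times> real \<Rightarrow> nat set"
      by (auto simp: increasing_choices_def)
    then show ?thesis using Nil by simp
  next
    case (Cons h gs1)
    define b where "b = Suc (length (takeWhile ((=) h) gs1))"
    define gs' where "gs' = dropWhile ((=) h) gs1"
    have "takeWhile ((=) h) gs1 = replicate (length (takeWhile ((=) h) gs1)) h"
      by (rule sym, rule replicate_length_same) (auto dest: set_takeWhileD)
    then have gs: "gs = replicate b h @ gs'"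
      unfolding Cons b_def gs'_def by (metis append_Cons replicate_Suc takeWhile_dropWhile_id)
    have h: "in_Theta h" using less.prems Cons by simp
    \<comment> \<open>The detour through the first label \<open>k\<close> after the run shows that
      \<open>h\<close> cannot return later: \<open>snd h \<le> fst k < snd k \<le> fst g\<close>
      unless \<open>g = k\<close>.\<close>
    have after: "snd h \<le> fst g" if g: "g \<in> set gs'" for g
    proof -
      obtain k ks where k: "gs' = k # ks" using g by (cases gs') auto
      have "k \<noteq> h" using k hd_dropWhile[of "(=) h" gs1] by (auto simp: gs'_def)
      have T: "in_Theta k" "in_Theta g" using less.prems(2) gs k g by auto
      have "theta_le h k" using less.prems(1) gs k by (auto simp: sorted_wrt_append b_def)
      then have hk: "snd h \<le> fst k"
        using \<open>k \<noteq> h\<close> chi_eq_iff[OF h T(1)] by (auto simp: theta_le_def theta_less_def)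
      show ?thesis
      proof (cases "g = k")
        case False
        then have "theta_le k g" using less.prems(1) gs k g by (auto simp: sorted_wrt_append)
        then have "snd k \<le> fst g"
          using False chi_eq_iff[OF T(1,2)] by (auto simp: theta_le_def theta_less_def)
        then show ?thesis using hk T by (auto simp: in_Theta_def)
      qed (use hk in simp)
    qed
    have notin: "h \<notin> set gs'" using after[of h] h by (auto simp: in_Theta_def)
    have card: "card (increasing_choices (index_interval N) gs) =
        (card (index_interval N h) choose b) * card (increasing_choices (index_interval N) gs')" for N
      unfolding gs
      by (subst card_increasing_choices_append)
        (auto simp: card_increasing_choices_replicate intro: index_interval_less after)
    have "(\<lambda>N. real (card (increasing_choices (index_interval N) gs')) / real N ^ length gs')
      \<longlonglongrightarrow> prod_list (map (\<lambda>g. snd g - fst g) gs') / (\<Prod>g\<in>set gs'. fact (count_list gs' g))"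
      using less.prems gs by (intro less.hyps) (auto simp: sorted_wrt_append b_def)
    then have "(\<lambda>N. real (card (index_interval N h) choose b) / real N ^ b *
        (real (card (increasing_choices (index_interval N) gs')) / real N ^ length gs'))
      \<longlonglongrightarrow> (snd h - fst h) ^ b / fact b *
        (prod_list (map (\<lambda>g. snd g - fst g) gs') / (\<Prod>g\<in>set gs'. fact (count_list gs' g)))"
      by (intro tendsto_mult binomial_over_power_tendsto card_index_interval_tendsto h)
    moreover have "(\<Prod>g\<in>set gs. fact (count_list gs g)) =
        fact b * (\<Prod>g\<in>set gs'. fact (count_list gs' g) :: real)"
    proof -
      have rep: "count_list (replicate c h) g = (if g = h then c else 0)" for c g
        by (induction c) auto
      have "set gs = insert h (set gs')" using gs by (auto simp: b_def)
      moreover have "count_list gs h = b" using gs notin by (simp add: rep)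
      moreover have "count_list gs g = count_list gs' g" if "g \<in> set gs'" for g
        using that notin gs by (auto simp: rep)
      ultimately show ?thesis using notin by simp
    qed
    moreover have "prod_list (map (\<lambda>g. snd g - fst g) gs) =
        (snd h - fst h) ^ b * prod_list (map (\<lambda>g. snd g - fst g) gs')"
      using gs by simp
    moreover have "length gs = b + length gs'" using gs by simp
    ultimately show ?thesis by (simp add: card power_add)
  qed
qed

section \<open>Words with a prescribed ordered kernel\<close>

locale disjoint_intervals =
  fixes fs :: "(real \<times> real) list"
  assumes Theta: "\<forall>f\<in>set fs. in_Theta f"
    and disj: "\<forall>j<length fs. \<forall>l<length fs.
      chi (fs ! j) = chi (fs ! l) \<or> snd (fs ! j) \<le> fst (fs ! l) \<or> snd (fs ! l) \<le> fst (fs ! j)"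
begin

lemma chi_nth_eq_iff:
  "j < length fs \<Longrightarrow> l < length fs \<Longrightarrow> chi (fs ! j) = chi (fs ! l) \<longleftrightarrow> fs ! j = fs ! l"
  using Theta by (intro chi_eq_iff) auto

text \<open>Distinct intervals have disjoint and ordered index sets: a common letter forces a common
  interval, and a smaller letter cannot come from a later one. The restriction to compatible
  partitions in the limit thus arises by itself.\<close>

lemma compatible_word_partition:
  assumes w: "w \<in> choices (index_interval N) fs"
  shows "compatible (word_partition w) fs"
proof -
  let ?v = "sorted_list_of_set (set w)"
  have len: "length w = length fs" and mem: "\<And>p. p < length fs \<Longrightarrow> w ! p \<in> index_interval N (fs ! p)"
    using w by (auto simp: mem_choices_iff)
  have block: "i < length fs \<and> w ! i = ?v ! k"
    if "k < card (set w)" "i \<in> word_partition w ! k" for i k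
    using that len by (auto simp: word_partition_nth letter_positions_def)
  show ?thesis
    unfolding compatible_def length_word_partition
  proof (intro conjI allI impI ballI)
    fix k i j assume k: "k < card (set w)" "i \<in> word_partition w ! k" "j \<in> word_partition w ! k"
    then have ij: "i < length fs" "j < length fs" "w ! i = w ! j" using block by metis+
    then show "chi (fs ! i) = chi (fs ! j)"
      using disj[rule_format, OF ij(1,2)] mem[OF ij(1)] mem[OF ij(2)]
        index_interval_less[of "fs ! i" "fs ! j" "w ! i" N "w ! j"]
        index_interval_less[of "fs ! j" "fs ! i" "w ! j" N "w ! i"] by auto
  next
    fix k l i j assume k: "k < card (set w)" "l < card (set w)" "k < l"
      "i \<in> word_partition w ! k" "j \<in> word_partition w ! l"
    then have ij: "i < length fs" "j < length fs" using block by blast+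
    have "w ! i < w ! j"
      using k block[of k i] block[of l j] by (simp add: sorted_list_of_set_nth_less_iff)
    then show "theta_le (fs ! i) (fs ! j)"
      using disj[rule_format, OF ij(1,2)] mem[OF ij(1)] mem[OF ij(2)]
        index_interval_less[of "fs ! j" "fs ! i" "w ! j" N "w ! i"]
      by (auto simp: theta_le_def theta_less_def)
  qed
qed

end

locale compatible_pairing = disjoint_intervals fs for fs +
  fixes P :: "nat set list" and m :: nat
  assumes P: "P \<in> ONC2 (length fs) m" and compat: "compatible P fs"
begin

text \<open>The interval of each block, in the order of colours. \<open>Min B\<close> merely picks a
  representative, since compatibility makes \<open>fs\<close> constant on blocks.\<close>

definition block_intervals :: "(real \<times> real) list" where
  "block_intervals = map (\<lambda>B. fs ! Min B) P"

lemma partition: "ordered_partition (length fs) P"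
  and block_card: "B \<in> set P \<Longrightarrow> card B = 2"
  using P by (auto simp: ONC2_def ONC_def)

lemma block_subset: "r < length P \<Longrightarrow> p \<in> P ! r \<Longrightarrow> p < length fs"
  using partition unfolding ordered_partition_def by (metis UnionI lessThan_iff nth_mem)

lemma block_exists: "p < length fs \<Longrightarrow> \<exists>r<length P. p \<in> P ! r"
  using partition unfolding ordered_partition_def by (metis UnionE in_set_conv_nth lessThan_iff)

lemma block_unique: "r < length P \<Longrightarrow> s < length P \<Longrightarrow> p \<in> P ! r \<Longrightarrow> p \<in> P ! s \<Longrightarrow> r = s"
  using partition unfolding ordered_partition_def by blast

lemma block_finite: "r < length P \<Longrightarrow> finite (P ! r) \<and> P ! r \<noteq> {}"
  using block_card[of "P ! r"] by (metis card.empty card.infinite nth_mem zero_neq_numeral)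

lemma fs_block:
  assumes "r < length P" "p \<in> P ! r"
  shows "fs ! p = block_intervals ! r"
proof -
  have "Min (P ! r) \<in> P ! r" using block_finite[OF assms(1)] by auto
  then have "chi (fs ! p) = chi (fs ! Min (P ! r))"
    using compat assms unfolding compatible_def by blast
  then show ?thesis
    using assms block_subset \<open>Min (P ! r) \<in> P ! r\<close> chi_nth_eq_iff by (auto simp: block_intervals_def)
qed

lemma length_block_intervals [simp]: "length block_intervals = length P"
  by (simp add: block_intervals_def)

lemma block_intervals_mem:
  assumes "r < length P"
  obtains p where "p \<in> P ! r" "p < length fs" "block_intervals ! r = fs ! p"
  using assms block_finite[OF assms] fs_block block_subset by (metis all_not_in_conv)

lemma set_block_intervals: "set block_intervals = set fs"
proof (intro set_eqI iffI)
  fix g assume "g \<in> set block_intervals"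
  then obtain r where "r < length P" "block_intervals ! r = g"
    by (auto simp: in_set_conv_nth)
  then show "g \<in> set fs" using block_intervals_mem by (metis nth_mem)
next
  fix g assume "g \<in> set fs"
  then obtain p where "p < length fs" "fs ! p = g" by (auto simp: in_set_conv_nth)
  then show "g \<in> set block_intervals"
    using block_exists fs_block by (metis length_block_intervals nth_mem)
qed

lemma sorted_block_intervals: "sorted_wrt theta_le block_intervals"
  unfolding sorted_wrt_iff_nth_less length_block_intervals
proof (intro allI impI)
  fix r s assume rs: "r < s" "s < length P"
  obtain p where p: "p \<in> P ! r" "block_intervals ! r = fs ! p"
    using block_intervals_mem[of r] rs by auto
  obtain q where q: "q \<in> P ! s" "block_intervals ! s = fs ! q"
    using block_intervals_mem[of s] rs by auto
  show "theta_le (block_intervals ! r) (block_intervals ! s)"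
    using compat[unfolded compatible_def, THEN conjunct2, rule_format, of r s p q] rs p q by simp
qed

text \<open>Each block with interval \<open>g\<close> uses two positions carrying \<open>g\<close>.
  So the number of blocks in an interval is half the size of the corresponding class of
  \<open>sigma_part\<close>, the same for all compatible pairings, and the later
  \<open>div 2\<close> is exact.\<close>

lemma count_list_block_intervals: "count_list fs g = 2 * count_list block_intervals g"
proof -
  have "letter_positions fs g = (\<Union>r\<in>letter_positions block_intervals g. P ! r)"
    using block_exists block_subset fs_block
    by (auto simp: letter_positions_def) metis
  also have "card \<dots> = (\<Sum>r\<in>letter_positions block_intervals g. card (P ! r))"
  proof (rule card_UN_disjoint)
    show "finite (letter_positions block_intervals g)" by (simp add: letter_positions_def)
    show "\<forall>r\<in>letter_positions block_intervals g. finite (P ! r)"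
      using block_finite by (simp add: letter_positions_def)
    show "\<forall>r\<in>letter_positions block_intervals g. \<forall>s\<in>letter_positions block_intervals g.
        r \<noteq> s \<longrightarrow> P ! r \<inter> P ! s = {}"
      using block_unique by (auto simp: letter_positions_def)
  qed
  also have "\<dots> = (\<Sum>r\<in>letter_positions block_intervals g. 2)"
    by (intro sum.cong refl block_card nth_mem) (simp add: letter_positions_def)
  finally show ?thesis by (simp add: count_list_eq_card)
qed

lemma length_fs: "length fs = 2 * length P"
proof -
  have "length fs = (\<Sum>g\<in>set fs. count_list fs g)" by (simp add: sum_count_set)
  also have "\<dots> = 2 * (\<Sum>g\<in>set block_intervals. count_list block_intervals g)"
    by (simp add: count_list_block_intervals set_block_intervals sum_distrib_left)
  also have "\<dots> = 2 * length P" by (simp add: sum_count_set)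
  finally show ?thesis .
qed

lemma prod_inner_blocks:
  "(\<Prod>B\<in>set P. L2_inner (chi (fs ! Min B)) (chi (fs ! Max B))) =
    prod_list (map (\<lambda>g. snd g - fst g) block_intervals)"
proof -
  have "(\<Prod>B\<in>set P. L2_inner (chi (fs ! Min B)) (chi (fs ! Max B))) =
      prod_list (map (\<lambda>B. L2_inner (chi (fs ! Min B)) (chi (fs ! Max B))) P)"
    using ordered_partition_distinct[OF partition] by (rule prod.distinct_set_conv_list)
  also have "map (\<lambda>B. L2_inner (chi (fs ! Min B)) (chi (fs ! Max B))) P =
      map (\<lambda>g. snd g - fst g) block_intervals"
  proof (rule nth_equalityI)
    fix r assume "r < length (map (\<lambda>B. L2_inner (chi (fs ! Min B)) (chi (fs ! Max B))) P)"
    then have r: "r < length P" by simp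
    have "Min (P ! r) \<in> P ! r" "Max (P ! r) \<in> P ! r" using block_finite[OF r] by auto
    then have "fs ! Min (P ! r) = block_intervals ! r" "fs ! Max (P ! r) = block_intervals ! r"
      using fs_block[OF r] by auto
    moreover have "in_Theta (block_intervals ! r)"
      using Theta r set_block_intervals by (metis length_block_intervals nth_mem)
    ultimately show "map (\<lambda>B. L2_inner (chi (fs ! Min B)) (chi (fs ! Max B))) P ! r =
        map (\<lambda>g. snd g - fst g) block_intervals ! r"
      using r by (simp add: L2_inner_chi)
  qed simp
  finally show ?thesis .
qed

definition block_of :: "nat \<Rightarrow> nat" where
  "block_of p = (THE r. r < length P \<and> p \<in> P ! r)"

lemma block_of:
  assumes "p < length fs"
  shows "block_of p < length P" "p \<in> P ! block_of p"
proof -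
  have "\<exists>!r. r < length P \<and> p \<in> P ! r" using block_exists[OF assms] block_unique by blast
  from theI'[OF this] show "block_of p < length P" "p \<in> P ! block_of p"
    unfolding block_of_def by auto
qed

lemma block_of_eq_iff: "p < length fs \<Longrightarrow> r < length P \<Longrightarrow> block_of p = r \<longleftrightarrow> p \<in> P ! r"
  using block_of block_unique by blast

text \<open>A word with ordered partition \<open>P\<close> is determined by its increasing list of letters, and every
  increasing list of letters taken from the intervals of the blocks occurs.\<close>

lemma card_words_of_partition:
  "card {w \<in> choices I fs. word_partition w = P} = card (increasing_choices I block_intervals)"
proof -
  let ?W = "{w \<in> choices I fs. word_partition w = P}"
  let ?f = "\<lambda>w. sorted_list_of_set (set w)" and ?g = "\<lambda>v. map (\<lambda>p. v ! block_of p) [0..<length fs]"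
  have W: "length w = length fs" "card (set w) = length P"
    "\<And>r p. r < length P \<Longrightarrow> p \<in> P ! r \<Longrightarrow> w ! p = ?f w ! r"
    if w: "w \<in> ?W" for w
  proof -
    show "length w = length fs" using w by (simp add: mem_choices_iff)
    show c: "card (set w) = length P" using w length_word_partition[of w] by auto
    show "w ! p = ?f w ! r" if "r < length P" "p \<in> P ! r" for r p
      using that c w word_partition_nth[of r w] by (auto simp: letter_positions_def)
  qed
  have gf: "\<forall>w\<in>?W. ?g (?f w) = w"
  proof
    fix w assume w: "w \<in> ?W"
    show "?g (?f w) = w"
    proof (rule nth_equalityI)
      fix p assume "p < length (?g (?f w))"
      then have p: "p < length fs" by simp
      show "?g (?f w) ! p = w ! p" using W(3)[OF w block_of[OF p]] p by simp
    qed (use W(1)[OF w] in simp)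
  qed
  have f_into: "?f ` ?W \<subseteq> increasing_choices I block_intervals"
  proof (rule image_subsetI)
    fix w assume w: "w \<in> ?W"
    have "?f w ! r \<in> I (block_intervals ! r)" if r: "r < length P" for r
    proof -
      obtain p where "p \<in> P ! r" "p < length fs" "block_intervals ! r = fs ! p"
        using block_intervals_mem[OF r] .
      then show ?thesis using W(3)[OF w r] w by (auto simp: mem_choices_iff)
    qed
    then show "?f w \<in> increasing_choices I block_intervals"
      using W(2)[OF w] by (auto simp: increasing_choices_def mem_choices_iff)
  qed
  have V: "length v = length P" "sorted_wrt (<) v"
    "\<And>r. r < length P \<Longrightarrow> v ! r \<in> I (block_intervals ! r)" "set (?g v) = set v"
    if v: "v \<in> increasing_choices I block_intervals" for v
  proof -
    show len: "length v = length P"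
      using v by (simp add: increasing_choices_def mem_choices_iff)
    show "sorted_wrt (<) v" using v by (simp add: increasing_choices_def)
    show "v ! r \<in> I (block_intervals ! r)" if "r < length P" for r
      using v that by (simp add: increasing_choices_def mem_choices_iff)
    show "set (?g v) = set v"
    proof (intro set_eqI iffI)
      fix a assume "a \<in> set (?g v)"
      then show "a \<in> set v" using block_of(1) len by auto
    next
      fix a assume "a \<in> set v"
      then obtain r where r: "r < length P" "v ! r = a" using len by (auto simp: in_set_conv_nth)
      obtain p where p: "p \<in> P ! r" "p < length fs" using block_intervals_mem[OF r(1)] by blast
      then have "block_of p = r" using block_of_eq_iff r by blast
      then show "a \<in> set (?g v)" using p r by force
    qed
  qed
  have fg: "?f (?g v) = v" if v: "v \<in> increasing_choices I block_intervals" for v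
    unfolding V(4)[OF v]
    using V(2)[OF v] by (auto simp: strict_sorted_iff sorted_list_of_set.idem_if_sorted_distinct)
  have g_into: "?g ` increasing_choices I block_intervals \<subseteq> ?W"
  proof (rule image_subsetI)
    fix v assume v: "v \<in> increasing_choices I block_intervals"
    have "?g v \<in> choices I fs"
      unfolding mem_choices_iff
    proof (intro conjI allI impI)
      fix p assume p: "p < length fs"
      show "?g v ! p \<in> I (fs ! p)"
        using V(3)[OF v block_of(1)[OF p]] fs_block[OF block_of[OF p]] p by simp
    qed simp
    moreover have "word_partition (?g v) = P"
    proof (rule nth_equalityI)
      have len: "card (set (?g v)) = length P"
        unfolding V(4)[OF v] using V(1,2)[OF v] by (simp add: strict_sorted_iff distinct_card)
      then show "length (word_partition (?g v)) = length P"
        by (simp only: length_word_partition)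
      fix r assume "r < length (word_partition (?g v))"
      then have r: "r < length P" "r < card (set (?g v))" using len by (simp_all only: length_word_partition)
      have dist: "distinct v" using V(2)[OF v] by (simp add: strict_sorted_iff)
      have "word_partition (?g v) ! r = letter_positions (?g v) (v ! r)"
        using word_partition_nth[OF r(2)] unfolding fg[OF v] .
      also have "\<dots> = {p. p < length fs \<and> v ! block_of p = v ! r}"
        by (auto simp: letter_positions_def)
      also have "\<dots> = {p. p < length fs \<and> block_of p = r}"
        using dist V(1)[OF v] r block_of(1) by (auto simp: nth_eq_iff_index_eq)
      also have "\<dots> = P ! r"
        using block_of_eq_iff block_subset r by blast
      finally show "word_partition (?g v) ! r = P ! r" .
    qed
    ultimately show "?g v \<in> ?W" by blast
  qed
  have "bij_betw ?f ?W (increasing_choices I block_intervals)"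
    using gf fg f_into g_into by (intro bij_betw_byWitness[where f' = ?g]) blast+
  then show ?thesis by (rule bij_betw_same_card)
qed

lemma sigma_part_eq: "sigma_part fs = letter_positions fs ` set fs"
proof -
  have "sigma_part fs = (\<lambda>j. letter_positions fs (fs ! j)) ` {..<length fs}"
    unfolding sigma_part_def letter_positions_def
    by (intro image_cong refl Collect_cong) (auto simp: chi_nth_eq_iff)
  moreover have "set fs = (!) fs ` {..<length fs}" by (auto simp: set_conv_nth)
  ultimately show ?thesis by (simp add: image_image)
qed

lemma prod_fact_sigma_part:
  "(\<Prod>C\<in>sigma_part fs. fact (card C div 2)) =
    (\<Prod>g\<in>set block_intervals. fact (count_list block_intervals g))"
proof -
  have inj: "inj_on (letter_positions fs) (set fs)"
  proof (rule inj_onI)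
    fix g h assume "g \<in> set fs" and eq: "letter_positions fs g = letter_positions fs h"
    then obtain p where "p \<in> letter_positions fs g" by (auto simp: in_set_conv_nth letter_positions_def)
    moreover from this have "p \<in> letter_positions fs h" using eq by simp
    ultimately show "g = h" by (simp add: letter_positions_def)
  qed
  have "(\<Prod>C\<in>sigma_part fs. fact (card C div 2)) = (\<Prod>g\<in>set fs. fact (count_list fs g div 2))"
    unfolding sigma_part_eq by (simp add: prod.reindex[OF inj] count_list_eq_card)
  then show ?thesis by (simp add: set_block_intervals count_list_block_intervals)
qed

lemma words_of_partition_tendsto:
  "(\<lambda>N. real (card {w \<in> choices (index_interval N) fs. word_partition w = P}) / sqrt (real N) ^ length fs)
    \<longlonglongrightarrow> (1 / (\<Prod>C\<in>sigma_part fs. fact (card C div 2))) *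
      (\<Prod>B\<in>set P. L2_inner (chi (fs ! Min B)) (chi (fs ! Max B)))"
proof -
  have "sqrt (real N) ^ length fs = real N ^ length block_intervals" for N
    by (simp add: length_fs power_mult)
  moreover have "\<forall>g\<in>set block_intervals. in_Theta g" using Theta by (simp add: set_block_intervals)
  ultimately show ?thesis
    using increasing_choices_tendsto[OF sorted_block_intervals]
    by (simp add: card_words_of_partition prod_inner_blocks prod_fact_sigma_part)
qed

end

section \<open>Negligible words and passage to the limit\<close>

lemma few_letters_negligible:
  fixes d n :: nat and T :: real
  assumes "2 * d < n" "0 \<le> T"
  shows "(\<lambda>N. real (Suc (nat \<lfloor>T * real N\<rfloor>) ^ d * d ^ n) / sqrt (real N) ^ n) \<longlonglongrightarrow> 0"
proof (rule tendsto_sandwich[where f = "\<lambda>_. 0"])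
  \<comment> \<open>For \<open>N \<ge> 1\<close> the alphabet size
    \<open>Suc (nat \<lfloor>T * real N\<rfloor>)\<close> is at most \<open>(T + 1) * N\<close>,
    which accounts for the first factor.\<close>
  let ?K = "(T + 1) ^ d * real d ^ n"
  show "\<forall>\<^sub>F N in sequentially.
      real (Suc (nat \<lfloor>T * real N\<rfloor>) ^ d * d ^ n) / sqrt (real N) ^ n \<le> ?K * (1 / sqrt (real N))"
  proof (rule eventually_mono[OF eventually_ge_at_top[of 1]])
    fix N :: nat assume N: "1 \<le> N"
    have "real (nat \<lfloor>T * real N\<rfloor>) \<le> T * real N" using assms by simp
    then have "real (Suc (nat \<lfloor>T * real N\<rfloor>)) \<le> (T + 1) * real N"
      using N by (simp add: distrib_right)
    then have "real (Suc (nat \<lfloor>T * real N\<rfloor>)) ^ d \<le> ((T + 1) * real N) ^ d"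
      by (intro power_mono) auto
    then have "real (Suc (nat \<lfloor>T * real N\<rfloor>)) ^ d * real d ^ n \<le> ((T + 1) * real N) ^ d * real d ^ n"
      by (rule mult_right_mono) simp
    then have num: "real (Suc (nat \<lfloor>T * real N\<rfloor>) ^ d * d ^ n) \<le> ?K * real N ^ d"
      by (simp add: power_mult_distrib mult_ac)
    \<comment> \<open>From \<open>2 * d < n\<close> the normalisation has at least one factor
      \<open>sqrt N\<close> to spare, and that factor gives the decay.\<close>
    have "real N ^ d * sqrt (real N) = sqrt (real N) ^ (2 * d + 1)"
      by (simp add: power_mult)
    also have "\<dots> \<le> sqrt (real N) ^ n"
      using assms N by (intro power_increasing) auto
    finally have den: "real N ^ d * sqrt (real N) \<le> sqrt (real N) ^ n" .
    have "real (Suc (nat \<lfloor>T * real N\<rfloor>) ^ d * d ^ n) / sqrt (real N) ^ n \<le>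
        (?K * real N ^ d) / (real N ^ d * sqrt (real N))"
      using N assms by (intro frac_le num den) auto
    also have "\<dots> = ?K * (1 / sqrt (real N))" using N by simp
    finally show "real (Suc (nat \<lfloor>T * real N\<rfloor>) ^ d * d ^ n) / sqrt (real N) ^ n \<le>
        ?K * (1 / sqrt (real N))" .
  qed
  have "(\<lambda>N. sqrt (1 / real N)) \<longlonglongrightarrow> sqrt 0"
    by (intro tendsto_real_sqrt lim_1_over_n)
  then have "(\<lambda>N. ?K * (1 / sqrt (real N))) \<longlonglongrightarrow> ?K * 0"
    by (intro tendsto_mult tendsto_const) (simp add: real_sqrt_divide)
  then show "(\<lambda>N. ?K * (1 / sqrt (real N))) \<longlonglongrightarrow> 0" by simp
  show "\<forall>\<^sub>F N in sequentially. 0 \<le> real (Suc (nat \<lfloor>T * real N\<rfloor>) ^ d * d ^ n) / sqrt (real N) ^ n"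
    by simp
qed simp

context disjoint_intervals
begin

text \<open>Right endpoints are positive, so their sum bounds each of them, and it makes sense for
  the empty list as well.\<close>

lemma choices_subset_atMost:
  assumes "w \<in> choices (index_interval N) fs"
  shows "set w \<subseteq> {..nat \<lfloor>(\<Sum>f\<leftarrow>fs. snd f) * real N\<rfloor>}"
proof
  fix x assume "x \<in> set w"
  then obtain p where p: "p < length fs" "x \<in> index_interval N (fs ! p)"
    using assms by (auto simp: mem_choices_iff in_set_conv_nth)
  have "snd (fs ! p) \<le> (\<Sum>f\<leftarrow>fs. snd f)"
    using Theta p by (intro member_le_sum_list) (auto simp: in_Theta_def)
  then have "nat \<lfloor>snd (fs ! p) * real N\<rfloor> \<le> nat \<lfloor>(\<Sum>f\<leftarrow>fs. snd f) * real N\<rfloor>"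
    by (intro nat_mono floor_mono mult_right_mono) auto
  then show "x \<in> {..nat \<lfloor>(\<Sum>f\<leftarrow>fs. snd f) * real N\<rfloor>}"
    using p(2) by (simp add: index_interval_def)
qed

lemma words_of_partitions_tendsto:
  "(\<lambda>N. real (card {w \<in> choices (index_interval N) fs. word_partition w \<in> ONC2 (length fs) m})
      / sqrt (real N) ^ length fs)
    \<longlonglongrightarrow> (1 / (\<Prod>C\<in>sigma_part fs. fact (card C div 2))) *
      (\<Sum>P\<in>{P \<in> ONC2 (length fs) m. compatible P fs}.
        \<Prod>B\<in>set P. L2_inner (chi (fs ! Min B)) (chi (fs ! Max B)))"
proof -
  let ?Q = "{P \<in> ONC2 (length fs) m. compatible P fs}"
  let ?F = "\<lambda>N P. {w \<in> choices (index_interval N) fs. word_partition w = P}"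
  have fin: "finite (choices (index_interval N) fs)" for N by (rule finite_choices) simp
  \<comment> \<open>Compatibility of the kernel is automatic for these words, so they split over a
    finite set of partitions that does not depend on \<open>N\<close>.\<close>
  have "{w \<in> choices (index_interval N) fs. word_partition w \<in> ONC2 (length fs) m} =
      (\<Union>P\<in>?Q. ?F N P)" for N
    using compatible_word_partition by blast
  then have "card {w \<in> choices (index_interval N) fs. word_partition w \<in> ONC2 (length fs) m} =
      (\<Sum>P\<in>?Q. card (?F N P))" for N
    using fin[of N] finite_ONC2 by (simp add: card_UN_disjoint disjoint_iff)
  then have eq: "real (card {w \<in> choices (index_interval N) fs. word_partition w \<in> ONC2 (length fs) m})
      / sqrt (real N) ^ length fs = (\<Sum>P\<in>?Q. real (card (?F N P)) / sqrt (real N) ^ length fs)" for N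
    by (simp add: sum_divide_distrib)
  show ?thesis
    unfolding eq sum_distrib_left
  proof (rule tendsto_sum)
    fix P assume "P \<in> ?Q"
    then interpret compatible_pairing fs P m by unfold_locales auto
    show "(\<lambda>N. real (card (?F N P)) / sqrt (real N) ^ length fs)
      \<longlonglongrightarrow> 1 / (\<Prod>C\<in>sigma_part fs. fact (card C div 2)) *
        (\<Prod>B\<in>set P. L2_inner (chi (fs ! Min B)) (chi (fs ! Max B)))"
      by (rule words_of_partition_tendsto)
  qed
qed

end

theorem theorem9p1:
  fixes m :: nat
    and sm :: "complex \<Rightarrow> 'a::ring_1 \<Rightarrow> 'a" and st :: "'a \<Rightarrow> 'a" and \<phi> :: "'a \<Rightarrow> complex"
    and X :: "nat \<Rightarrow> 'a"
    and fs :: "(real \<times> real) list"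
  assumes "m \<ge> 1"
    and "nc_prob_space sm st \<phi>"
    and "m_monotone_vars m sm st \<phi> X"
    and "identically_distributed \<phi> X"
    and "\<And>i. \<phi> (X i) = 0"
    and "\<And>i. \<phi> (X i ^ 2) = 1"
    and "\<forall>f\<in>set fs. in_Theta f"
    and "\<forall>j<length fs. \<forall>l<length fs.
           chi (fs ! j) = chi (fs ! l) \<or> snd (fs ! j) \<le> fst (fs ! l) \<or> snd (fs ! l) \<le> fst (fs ! j)"
  shows "(\<lambda>N. \<phi> (prod_list (map (S_N sm X N) fs)))
     \<longlonglongrightarrow> complex_of_real
          ((1 / (\<Prod>C\<in>sigma_part fs. fact (card C div 2))) *
           (\<Sum>P\<in>{P \<in> ONC2 (length fs) m. compatible P fs}.
              \<Prod>B\<in>set P. L2_inner (chi (fs ! Min B)) (chi (fs ! Max B))))"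
proof -
  obtain Alg where Alg: "m_monotone m sm st \<phi> Alg" "\<And>i. X i \<in> Alg i"
    using assms(3) unfolding m_monotone_vars_def by blast
  obtain u where u: "m_monotone_units m sm st \<phi> Alg u"
    using Alg(1) unfolding m_monotone_def by blast
  interpret m_monotone_sequence m sm st \<phi> Alg u X
    using assms(1,2,4-6) Alg u by unfold_locales (auto simp: identically_distributed_def)
  interpret disjoint_intervals fs using assms(7,8) by unfold_locales auto
  let ?n = "length fs"
  let ?W = "\<lambda>N. choices (index_interval N) fs"
  let ?E = "\<lambda>w. \<phi> (prod_list (map X w))"
  let ?good = "\<lambda>w. word_partition w \<in> ONC2 ?n m"
  have fin: "finite (?W N)" for N by (rule finite_choices) simp
  have len: "length w = ?n" if "w \<in> ?W N" for w N using that by (simp add: mem_choices_iff)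
  have expand: "\<phi> (prod_list (map (S_N sm X N) fs)) = (\<Sum>w\<in>?W N. ?E w) / sqrt (real N) ^ ?n" for N
  proof -
    have "S_N sm X N = (\<lambda>f. sm (1 / sqrt (real N)) (\<Sum>i\<in>index_interval N f. X i))"
      by (simp add: S_N_def index_interval_def fun_eq_iff)
    then show ?thesis
      by (simp add: prod_list_sm prod_list_sum_choices phi_sm phi_sum power_one_over)
  qed
  obtain C where C: "\<And>w. length w = ?n \<Longrightarrow> cmod (?E w) \<le> C"
    using moments_bounded[of ?n] by blast
  \<comment> \<open>For a nonempty list this is the largest \<open>d\<close> with
    \<open>2 * d < ?n\<close>; for the empty list there are no rare words at all.\<close>
  define d where "d = (?n - 1) div 2"
  define T where "T = (\<Sum>f\<leftarrow>fs. snd f)"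
  have "0 \<le> T" unfolding T_def using Theta by (intro sum_list_nonneg) (auto simp: in_Theta_def)
  \<comment> \<open>Outside \<open>rare\<close> the moment is known exactly: the word is a pair
    word, or some letter occurs only once and both sides of the comparison vanish.\<close>
  define rare where "rare N = {w \<in> ?W N. 2 * card (set w) < ?n}" for N
  have diff: "?E w = of_bool (?good w)" if w: "w \<in> ?W N - rare N" for w N
  proof (cases "pair_word w")
    case True
    then show ?thesis
      using pair_word_moment[of w] word_partition_ONC2_iff[of w m] len w by auto
  next
    case False
    then obtain a where "count_list w a = 1"
      using no_singleton_few_letters[of w] w len[of w N] unfolding rare_def by force
    then show ?thesis
      using moment_singleton_zero[of w a] False word_partition_ONC2_iff[of w m] len w by auto
  qed
  have rare_diff: "cmod (?E w - of_bool (?good w)) \<le> \<bar>C\<bar> + 1" if "w \<in> rare N" for w N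
    using C[of w] len[of w N] that norm_triangle_ineq4[of "?E w" "of_bool (?good w)"]
    by (auto simp: rare_def split: if_splits)
  \<comment> \<open>Each moment is replaced by its combinatorial value; the error is supported on
    the rare words and uniformly bounded there.\<close>
  have split: "(\<Sum>w\<in>?W N. ?E w) = of_nat (card {w \<in> ?W N. ?good w}) +
      (\<Sum>w\<in>rare N. ?E w - of_bool (?good w))" for N
  proof -
    have "(\<Sum>w\<in>?W N. ?E w) = (\<Sum>w\<in>?W N. of_bool (?good w)) + (\<Sum>w\<in>?W N. ?E w - of_bool (?good w))"
      by (simp add: sum.distrib[symmetric])
    also have "(\<Sum>w\<in>?W N. ?E w - of_bool (?good w)) = (\<Sum>w\<in>rare N. ?E w - of_bool (?good w))"
    proof (rule sum.mono_neutral_right[OF fin])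
      show "rare N \<subseteq> ?W N" by (auto simp: rare_def)
      show "\<forall>w\<in>?W N - rare N. ?E w - of_bool (?good w) = 0" using diff by simp
    qed
    also have "(\<Sum>w\<in>?W N. of_bool (?good w)) = (of_nat (card {w \<in> ?W N. ?good w}) :: complex)"
      using fin by (simp add: sum_of_bool_eq Int_def)
    finally show ?thesis .
  qed
  have rest: "(\<lambda>N. (\<Sum>w\<in>rare N. ?E w - of_bool (?good w)) / sqrt (real N) ^ ?n) \<longlonglongrightarrow> 0"
  proof (cases "?n = 0")
    case True
    then show ?thesis by (simp add: rare_def)
  next
    case False
    then have d: "2 * d < ?n" unfolding d_def by linarith
    have bound: "cmod ((\<Sum>w\<in>rare N. ?E w - of_bool (?good w)) / sqrt (real N) ^ ?n)
        \<le> (\<bar>C\<bar> + 1) * (real (Suc (nat \<lfloor>T * real N\<rfloor>) ^ d * d ^ ?n) / sqrt (real N) ^ ?n)" for N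
    proof -
      have "rare N \<subseteq> {w. length w = ?n \<and> set w \<subseteq> {..nat \<lfloor>T * real N\<rfloor>} \<and> card (set w) \<le> d}"
        using choices_subset_atMost len unfolding rare_def T_def d_def by fastforce
      then have "card (rare N) \<le> Suc (nat \<lfloor>T * real N\<rfloor>) ^ d * d ^ ?n"
        using card_mono[OF card_few_letters_le(1)] card_few_letters_le(2) by (meson le_trans)
      then have c: "real (card (rare N)) \<le> real (Suc (nat \<lfloor>T * real N\<rfloor>) ^ d * d ^ ?n)"
        by (rule of_nat_mono)
      have "cmod (\<Sum>w\<in>rare N. ?E w - of_bool (?good w)) \<le> real (card (rare N)) * (\<bar>C\<bar> + 1)"
        using rare_diff by (intro sum_norm_bound)
      also have "\<dots> \<le> real (Suc (nat \<lfloor>T * real N\<rfloor>) ^ d * d ^ ?n) * (\<bar>C\<bar> + 1)"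
        by (intro mult_right_mono c) simp
      finally have "cmod (\<Sum>w\<in>rare N. ?E w - of_bool (?good w)) / sqrt (real N) ^ ?n \<le>
          real (Suc (nat \<lfloor>T * real N\<rfloor>) ^ d * d ^ ?n) * (\<bar>C\<bar> + 1) / sqrt (real N) ^ ?n"
        by (rule divide_right_mono) simp
      then show ?thesis by (simp add: norm_divide norm_power mult.commute)
    qed
    have "(\<lambda>N. (\<bar>C\<bar> + 1) * (real (Suc (nat \<lfloor>T * real N\<rfloor>) ^ d * d ^ ?n) / sqrt (real N) ^ ?n))
        \<longlonglongrightarrow> (\<bar>C\<bar> + 1) * 0"
      using few_letters_negligible[OF d \<open>0 \<le> T\<close>] by (intro tendsto_mult tendsto_const)
    then have "(\<lambda>N. (\<bar>C\<bar> + 1) * (real (Suc (nat \<lfloor>T * real N\<rfloor>) ^ d * d ^ ?n) / sqrt (real N) ^ ?n))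
        \<longlonglongrightarrow> 0" by simp
    then show ?thesis by (rule Lim_null_comparison[OF always_eventually, rotated]) (use bound in blast)
  qed
  have "\<phi> (prod_list (map (S_N sm X N) fs)) =
      complex_of_real (real (card {w \<in> ?W N. ?good w}) / sqrt (real N) ^ ?n) +
      (\<Sum>w\<in>rare N. ?E w - of_bool (?good w)) / sqrt (real N) ^ ?n" for N
    unfolding expand split by (simp add: add_divide_distrib)
  then show ?thesis
    using tendsto_add[OF tendsto_of_real[OF words_of_partitions_tendsto[of m]] rest] by simp
qed

end
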